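(* Let $\omega$ be an admissible modulus. Then there exist a real-valued function $f\in\bigcap_{1\le p<\infty}L^p(\mathbb T)$ with $\int_{\mathbb T} f=0$ and an increasing sequence of positive integers $(n_j)_{j\ge1}$ with $n_{j+1}/n_j\ge2$ for all $j$ such that $$\|f-S_Nf\|_2\ll \omega(N)$$ for all sufficiently large $N$, while $$\limsup_{N\to\infty}\frac1N\sum_{j\le N}f(n_jx)=+\infty$$ for almost every $x\in\mathbb T$.
   Context: $\mathbb T=\mathbb R/\mathbb Z$ with normalized Lebesgue measure; $\|\cdot\|_2$ is the $L^2(\mathbb T)$ norm. For $f\in L^2(\mathbb T)$, $S_Nf(x)=\sum_{|m|\le N}\widehat f(m)e^{2\pi i m x}$ is the symmetric Fourier partial sum. $A(N)\ll B(N)$ means $A(N)\le C\,B(N)$ for some constant $C>0$ independent of $N$. Admissibility: let $N_0\ge e^e$ and let $\omega:[N_0,\infty)\to(0,\infty)$ be decreasing. Then $\omega$ is called admissible if $$A^{1/2}\,\omega\bigl(\exp(\exp(2A\log A))\bigr)\longrightarrow\infty\qquad(A\to\infty).$$ *)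

theory Defs
  imports "HOL-Analysis.Analysis"
begin

text \<open>A function on the circle \<open>\<real>/\<int>\<close> is represented by a 1-periodic function on \<open>\<real>\<close>. The
  normalized Lebesgue measure on the circle is Lebesgue measure on the fundamental domain \<open>[0,1)\<close>.\<close>

definition circle_measure :: "real measure" where
  "circle_measure = lebesgue_on {0..<1}"

definition Lp_circle :: "real \<Rightarrow> (real \<Rightarrow> 'a::real_normed_vector) set" where
  "Lp_circle p = {f. (\<forall>x. f (x + 1) = f x) \<and> f \<in> borel_measurable circle_measure \<and>
     integrable circle_measure (\<lambda>x. norm (f x) powr p)}"

text \<open>Since the Bochner integral of a non-integrable function is 0, this is the \<open>L\<^sup>2\<close> norm only for
  \<open>f \<in> Lp_circle 2\<close>.\<close>

definition L2_norm_circle :: "(real \<Rightarrow> 'a::real_normed_vector) \<Rightarrow> real" where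
  "L2_norm_circle f = sqrt (LINT x|circle_measure. (norm (f x))\<^sup>2)"

definition fourier_coeff :: "(real \<Rightarrow> complex) \<Rightarrow> int \<Rightarrow> complex" where
  "fourier_coeff f m =
     (LINT x|circle_measure. f x * exp (- 2 * of_real pi * \<i> * of_int m * of_real x))"

definition fourier_partial_sum :: "nat \<Rightarrow> (real \<Rightarrow> complex) \<Rightarrow> real \<Rightarrow> complex" where
  "fourier_partial_sum N f x =
     (\<Sum>m\<in>{- int N..int N}. fourier_coeff f m * exp (2 * of_real pi * \<i> * of_int m * of_real x))"

text \<open>Only the values of \<open>\<omega>\<close> on \<open>[N\<^sub>0,\<infinity>)\<close> matter: the argument of \<open>\<omega>\<close> in the last
  condition is eventually in that range. ``Decreasing'' is understood in the weak sense.\<close>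

definition admissible :: "real \<Rightarrow> (real \<Rightarrow> real) \<Rightarrow> bool" where
  "admissible N\<^sub>0 \<omega> \<longleftrightarrow>
     exp (exp 1) \<le> N\<^sub>0 \<and> (\<forall>x\<ge>N\<^sub>0. 0 < \<omega> x) \<and> antimono_on {N\<^sub>0..} \<omega> \<and>
     filterlim (\<lambda>A. A powr (1/2) * \<omega> (exp (exp (2 * A * ln A)))) at_top at_top"

end

theory Submission
  imports Defs "HOL-Library.Discrete_Functions" "HOL-Real_Asymp.Real_Asymp"
begin

text \<open>Fix a large integer \<open>A\<close>, put \<open>L = 2\<^bsup>A+1\<^esup>\<close> and let \<open>b\<close> be of order \<open>A L\<close>. A trigonometric polynomial
  \<open>h\<close> with \<open>0 \<le> h \<le> 1\<close>, mean at most \<open>1/A\<close> and degree about \<open>b\<^bsup>L\<^esup>\<close> satisfies \<open>h(x) \<ge> 1/2\<close> whenever one of the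
  first \<open>L\<close> digits of \<open>x\<close> to base \<open>b\<close> is zero. If one of the digits in the second half of this range is
  zero, which has probability of order \<open>1/A\<close>, then \<open>h(b\<^bsup>j\<^esup> x) \<ge> 1/2\<close> for all \<open>j < L/2\<close> simultaneously. So the
  same \<open>h\<close> serves about \<open>A\<close> consecutive blocks of frequencies whose lengths double at each step, and
  the events belonging to different blocks are independent; one of them occurs with probability bounded below.

  Now let \<open>f = \<Sum>\<^sub>t (t + 1) (h\<^sub>t - mean)\<close> with \<open>A\<^sub>t\<close> growing rapidly. All the \<open>h\<^sub>t\<close> are nonnegative, so
  the stages do not cancel each other, and a successful block of stage \<open>t\<close> pushes the average up to
  \<open>(t + 1)/4 - O(1)\<close>. The \<open>t\<close>-th summand has \<open>L\<^sup>2\<close> norm at most \<open>(t + 1) A\<^sub>t\<^bsup>-1/2\<^esup>\<close> and is reproduced by \<open>S\<^sub>N\<close> for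
  \<open>N \<ge> exp (exp (2 A\<^sub>t log A\<^sub>t))\<close>; admissibility says that this is good enough.\<close>

subsection \<open>Fourier partial sums as best approximations\<close>

lemma space_circle_measure [simp]: "space circle_measure = {0..<1}"
  by (simp add: circle_measure_def)

lemma emeasure_circle_space [simp]: "emeasure circle_measure {0..<1} = 1"
  by (simp add: circle_measure_def emeasure_restrict_space)

lemma finite_measure_circle: "finite_measure circle_measure"
  by (rule finite_measureI) simp

lemma measure_circle_space [simp]: "measure circle_measure {0..<1} = 1"
  by (simp add: measure_def)

lemma borel_measurable_circle [measurable (raw)]:
  "f \<in> borel_measurable borel \<Longrightarrow> f \<in> borel_measurable circle_measure"
  unfolding circle_measure_def
  by (intro measurable_restrict_space1 measurable_completion) simp

lemma AE_circle_iff: "(AE x in circle_measure. P x) \<longleftrightarrow> (AE x in lborel. x \<in> {0..<1} \<longrightarrow> P x)"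
  unfolding circle_measure_def by (simp add: AE_restrict_space_iff AE_completion_iff)

lemma integrable_circle_continuous:
  fixes g :: "real \<Rightarrow> 'a::{banach,second_countable_topology,euclidean_space}"
  assumes "continuous_on UNIV g"
  shows "integrable circle_measure g"
proof -
  have "compact (g ` {0..1})"
    using assms continuous_on_subset by (intro compact_continuous_image) blast+
  then obtain B where B: "\<And>x. x \<in> {0..1} \<Longrightarrow> norm (g x) \<le> B"
    by (meson bounded_iff compact_imp_bounded imageI)
  show ?thesis
    using finite_measure_circle
    by (rule finite_measure.integrable_const_bound[where B = B])
       (use B assms in \<open>auto intro!: AE_I2 borel_measurable_circle borel_measurable_continuous_onI\<close>)
qed

lemma circle_FTC:
  fixes g :: "real \<Rightarrow> 'a::{banach,second_countable_topology,euclidean_space}"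
  assumes "\<And>x. (G has_vector_derivative g x) (at x)" "continuous_on UNIV g"
  shows "(LINT x|circle_measure. g x) = G 1 - G 0"
proof -
  have int: "integrable (lebesgue_on {0..<1}) g"
    using integrable_circle_continuous[OF assms(2)] by (simp add: circle_measure_def)
  have "(g has_integral (G 1 - G 0)) {0..1}"
    using assms(1) by (intro fundamental_theorem_of_calculus) (auto intro: has_vector_derivative_at_within)
  moreover have "(g has_integral (G 1 - G 0)) {0..1} \<longleftrightarrow> (g has_integral (G 1 - G 0)) {0..<1}"
    by (intro has_integral_spike_set_eq; rule negligible_subset[of "{1}"]) auto
  ultimately have "(g has_integral (G 1 - G 0)) {0..<1}"
    by blast
  then show ?thesis
    using int by (simp add: circle_measure_def lebesgue_integral_eq_integral integral_unique)
qed

section \<open>Characters and trigonometric polynomials\<close>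

definition "character m x = exp (2 * of_real pi * \<i> * of_int m * of_real x)" for m :: int and x :: real

lemma character_0 [simp]: "character 0 x = 1"
  by (simp add: character_def)

lemma character_add: "character (m + k) x = character m x * character k x"
  by (simp add: character_def ring_distribs exp_add)

lemma character_cnj: "cnj (character m x) = character (- m) x"
  by (simp add: character_def exp_cnj)

lemma norm_character [simp]: "norm (character m x) = 1"
  by (simp add: character_def norm_exp)

lemma character_int [simp]: "character m 1 = 1"
proof -
  have "character m 1 = exp (of_int (2 * m) * of_real pi * \<i>)"
    by (simp add: character_def algebra_simps)
  also have "\<dots> = 1"
    by (subst exp_integer_2pi[symmetric, of "of_int m"]) (auto simp: algebra_simps)
  finally show ?thesis .
qed

lemma character_mult: "character m (of_int q * x) = character (m * q) x"
  by (simp add: character_def algebra_simps)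

lemma continuous_on_character [continuous_intros]: "continuous_on S (character m)"
  unfolding character_def by (intro continuous_intros)

lemma fourier_coeff_character: "fourier_coeff f m = (LINT x|circle_measure. f x * cnj (character m x))"
  unfolding fourier_coeff_def character_cnj by (simp add: character_def)

lemma fourier_partial_sum_character:
  "fourier_partial_sum N f x = (\<Sum>m\<in>{- int N..int N}. fourier_coeff f m * character m x)"
  by (simp add: fourier_partial_sum_def character_def)

lemma integral_character: "(LINT x|circle_measure. character m x) = (if m = 0 then 1 else 0)"
proof (cases "m = 0")
  case False
  let ?c = "2 * of_real pi * \<i> * of_int m"
  have "(LINT x|circle_measure. character m x) = character m 1 / ?c - character m 0 / ?c"
  proof (rule circle_FTC)
    show "((\<lambda>x. character m x / ?c) has_vector_derivative character m x) (at x)" for x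
      unfolding character_def using False
      by (auto intro!: derivative_eq_intros has_vector_derivative_real_field)
  qed (intro continuous_intros)
  then show ?thesis using False by (simp add: character_def[of m 0])
qed simp

text \<open>Generation by monomials and sums turns each closure property into an induction;
  \<open>N\<close> is an upper bound for the degree. Explicit coefficients are recovered by
  \<open>trig_poly_coeffs\<close> for the projection argument.\<close>

inductive trig_poly :: "nat \<Rightarrow> (real \<Rightarrow> complex) \<Rightarrow> bool" for N where
  monomial: "\<bar>m\<bar> \<le> int N \<Longrightarrow> trig_poly N (\<lambda>x. c * character m x)"
| add: "trig_poly N f \<Longrightarrow> trig_poly N g \<Longrightarrow> trig_poly N (\<lambda>x. f x + g x)"

lemma trig_poly_coeffs:
  assumes "trig_poly N f"
  obtains p where "f = (\<lambda>x. \<Sum>m\<in>{- int N..int N}. p m * character m x)"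
proof -
  have "\<exists>p. f = (\<lambda>x. \<Sum>m\<in>{- int N..int N}. p m * character m x)"
    using assms
  proof induction
    case (monomial m c)
    have "(\<Sum>k\<in>{- int N..int N}. (if k = m then c else 0) * character k x) = c * character m x" for x
      using monomial by (simp add: if_distrib[of "\<lambda>a. a * _"] abs_le_iff cong: if_cong)
    then show ?case by (intro exI[of _ "\<lambda>k. if k = m then c else 0"]) auto
  next
    case (add f g)
    then obtain p q where "f = (\<lambda>x. \<Sum>m\<in>{- int N..int N}. p m * character m x)"
        "g = (\<lambda>x. \<Sum>m\<in>{- int N..int N}. q m * character m x)" by blast
    then show ?case
      by (intro exI[of _ "\<lambda>m. p m + q m"]) (simp add: ring_distribs sum.distrib)
  qed
  with that show ?thesis by blast
qed

lemma trig_poly_const: "trig_poly N (\<lambda>x. c)"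
  using trig_poly.monomial[of 0 N c] by simp

lemma trig_poly_mono: "trig_poly N f \<Longrightarrow> N \<le> M \<Longrightarrow> trig_poly M f"
  by (induction rule: trig_poly.induct) (auto intro: trig_poly.intros)

lemma trig_poly_mult:
  assumes "trig_poly N f" "trig_poly M g"
  shows "trig_poly (N + M) (\<lambda>x. f x * g x)"
  using assms(1)
proof induction
  case (monomial m c)
  show ?case
    using assms(2)
  proof induction
    case (monomial k d)
    then show ?case
      using \<open>\<bar>m\<bar> \<le> int N\<close> trig_poly.monomial[of "m + k" "N + M" "c * d"]
      by (simp add: character_add mult_ac)
  next
    case (add f g)
    then show ?case by (simp add: ring_distribs trig_poly.add)
  qed
next
  case (add f g)
  then show ?case by (simp add: ring_distribs trig_poly.add)
qed

lemma trig_poly_power: "trig_poly N f \<Longrightarrow> trig_poly (k * N) (\<lambda>x. f x ^ k)"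
  by (induction k) (auto intro: trig_poly_const trig_poly_mult)

lemma trig_poly_dilate:
  assumes "trig_poly N f"
  shows "trig_poly (q * N) (\<lambda>x. f (real q * x))"
  using assms
proof induction
  case (monomial m c)
  have "\<bar>m * int q\<bar> \<le> int (q * N)"
    using monomial by (simp add: abs_mult mult_right_mono mult.commute[of q])
  then show ?case
    using trig_poly.monomial character_mult[of m "int q"] by simp
qed (auto intro: trig_poly.add)

lemma trig_poly_scale: "trig_poly N f \<Longrightarrow> trig_poly N (\<lambda>x. c * f x)"
  using trig_poly_mult[OF trig_poly_const, of N f 0 c] by simp

lemma trig_poly_diff: "trig_poly N f \<Longrightarrow> trig_poly N g \<Longrightarrow> trig_poly N (\<lambda>x. f x - g x)"
  using trig_poly.add[of N f "\<lambda>x. - 1 * g x"] trig_poly_scale[of N g "-1"] by simp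

lemma trig_poly_of_real_one_minus:
  "trig_poly N (\<lambda>x. of_real (f x)) \<Longrightarrow> trig_poly N (\<lambda>x. of_real (1 - f x))"
  using trig_poly_diff[OF trig_poly_const[of N 1]] by simp

lemma trig_poly_sum: "(\<And>i. i \<in> I \<Longrightarrow> trig_poly N (f i)) \<Longrightarrow> trig_poly N (\<lambda>x. \<Sum>i\<in>I. f i x)"
  by (induction I rule: infinite_finite_induct) (auto intro: trig_poly_const trig_poly.add)

lemma trig_poly_prod:
  "(\<And>i. i \<in> I \<Longrightarrow> trig_poly (N i) (f i)) \<Longrightarrow> trig_poly (\<Sum>i\<in>I. N i) (\<lambda>x. \<Prod>i\<in>I. f i x)"
  by (induction I rule: infinite_finite_induct) (auto intro: trig_poly_const trig_poly_mult)

lemma trig_poly_cos_squared: "trig_poly 1 (\<lambda>x. of_real ((cos (pi * x))\<^sup>2))"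
proof -
  have eq: "of_real ((cos (pi * x))\<^sup>2) = 1 / 2 + (1 / 4 * character 1 x + 1 / 4 * character (- 1) x)" for x
  proof -
    have "character 1 x = cis (2 * pi * x)" for x
      by (simp add: character_def cis_conv_exp mult_ac)
    moreover have "character (- 1) x = cnj (character 1 x)" by (simp add: character_cnj)
    ultimately have "1 / 4 * character 1 x + 1 / 4 * character (- 1) x = of_real (cos (2 * (pi * x)) / 2)"
      by (simp add: complex_eq_iff mult_ac)
    moreover have "cos (2 * (pi * x)) / 2 = (cos (pi * x))\<^sup>2 - 1 / 2"
      by (simp only: cos_double_cos) (simp add: field_simps)
    ultimately show ?thesis by (simp only:) simp
  qed
  show ?thesis
    unfolding eq by (intro trig_poly.add trig_poly_const trig_poly.monomial) auto
qed

lemma norm_add_squared: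
  fixes a b :: complex
  shows "(norm (a + b))\<^sup>2 = (norm a)\<^sup>2 + (norm b)\<^sup>2 + 2 * Re (a * cnj b)"
  unfolding cmod_power2 by (simp add: power2_eq_square algebra_simps)

text \<open>The error of the partial sum is orthogonal to all characters of frequency at most
  \<open>N\<close>, so Pythagoras applies to its difference with any \<open>P\<close>. Decay then
  follows from exhibiting one good \<open>P\<close>, without computing a Fourier
  coefficient.\<close>

lemma fourier_partial_sum_best_approximation:
  assumes g: "g \<in> borel_measurable circle_measure"
    and g2: "integrable circle_measure (\<lambda>x. (norm (g x))\<^sup>2)"
    and P: "trig_poly N P"
  shows "L2_norm_circle (\<lambda>x. g x - fourier_partial_sum N g x)
    \<le> sqrt (LINT x|circle_measure. (norm (g x - P x))\<^sup>2)"
proof -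
  interpret finite_measure circle_measure by (rule finite_measure_circle)
  \<comment> \<open>The measure is finite, so square integrability gives integrability; the Fourier
    coefficients are genuine integrals and not the default value 0.\<close>
  have int_g: "integrable circle_measure g"
    using square_integrable_imp_integrable[of "\<lambda>x. norm (g x)"] g g2
    by (simp add: integrable_norm_iff)
  have char_meas: "character m \<in> borel_measurable circle_measure" for m
    by (intro borel_measurable_circle borel_measurable_continuous_onI continuous_intros)
  have int_gc: "integrable circle_measure (\<lambda>x. g x * cnj (character m x))" for m
    by (rule Bochner_Integration.integrable_bound[OF int_g])
       (use g char_meas in \<open>auto simp: norm_mult character_cnj\<close>)
  obtain p where p: "P = (\<lambda>x. \<Sum>m\<in>{- int N..int N}. p m * character m x)"
    using trig_poly_coeffs[OF P] .
  define S where "S = {- int N..int N}"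
  define c where "c = fourier_coeff g"
  define Q where "Q x = (\<Sum>m\<in>S. c m * character m x)" for x
  have Q: "fourier_partial_sum N g = Q"
    by (auto simp: fun_eq_iff fourier_partial_sum_character Q_def c_def S_def)
  define T where "T x = (\<Sum>m\<in>S. (c m - p m) * character m x)" for x
  have T: "T x = Q x - P x" for x
    by (simp add: T_def Q_def p S_def sum_subtractf ring_distribs)
  have cont: "continuous_on UNIV Q" "continuous_on UNIV T"
    unfolding Q_def T_def by (intro continuous_intros)+
  have meas: "Q \<in> borel_measurable circle_measure" "T \<in> borel_measurable circle_measure"
    using cont by (auto intro!: borel_measurable_circle borel_measurable_continuous_onI)
  have intQc: "integrable circle_measure (\<lambda>x. Q x * cnj (character k x))" for k
    by (intro integrable_circle_continuous continuous_intros cont)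
  have "(LINT x|circle_measure. Q x * cnj (character k x)) = c k" if "k \<in> S" for k
  proof -
    have "(LINT x|circle_measure. Q x * cnj (character k x)) = (LINT x|circle_measure. (\<Sum>m\<in>S. c m * character (m - k) x))"
      by (simp add: Q_def sum_distrib_right character_cnj mult.assoc flip: character_add)
    also have "\<dots> = (\<Sum>m\<in>S. c m * (LINT x|circle_measure. character (m - k) x))"
      by (subst Bochner_Integration.integral_sum)
         (auto intro!: integrable_circle_continuous continuous_intros)
    also have "\<dots> = c k"
      using that by (simp add: integral_character if_distrib S_def cong: if_cong)
    finally show ?thesis .
  qed
  then have orth: "(LINT x|circle_measure. (g x - Q x) * cnj (character k x)) = 0" if "k \<in> S" for k
    using that int_gc intQc by (simp add: left_diff_distrib c_def fourier_coeff_character)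
  have int_rc: "integrable circle_measure (\<lambda>x. (g x - Q x) * cnj (character k x))" for k
    using int_gc intQc by (simp add: left_diff_distrib)
  have rT: "(g x - Q x) * cnj (T x) = (\<Sum>k\<in>S. cnj (c k - p k) * ((g x - Q x) * cnj (character k x)))" for x
    by (simp add: T_def sum_distrib_left mult_ac)
  have int_rT: "integrable circle_measure (\<lambda>x. (g x - Q x) * cnj (T x))"
    unfolding rT by (intro Bochner_Integration.integrable_sum integrable_mult_right int_rc)
  have "(LINT x|circle_measure. (g x - Q x) * cnj (T x)) = 0"
    unfolding rT by (subst Bochner_Integration.integral_sum) (use orth int_rc in auto)
  then have ReT: "(LINT x|circle_measure. Re ((g x - Q x) * cnj (T x))) = 0"
    using integral_Re[OF int_rT] by simp
  have int_Q: "integrable circle_measure (\<lambda>x. (norm (Q x))\<^sup>2)"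
    by (intro integrable_circle_continuous continuous_intros cont)
  have int_sq: "integrable circle_measure (\<lambda>x. (norm (g x - Q x))\<^sup>2)"
  proof (rule Bochner_Integration.integrable_bound)
    show "integrable circle_measure (\<lambda>x. 2 * (norm (g x))\<^sup>2 + 2 * (norm (Q x))\<^sup>2)"
      using g2 int_Q by simp
    have "(norm (g x - Q x))\<^sup>2 \<le> 2 * (norm (g x))\<^sup>2 + 2 * (norm (Q x))\<^sup>2" for x
    proof -
      have "(norm (g x - Q x))\<^sup>2 \<le> (norm (g x) + norm (Q x))\<^sup>2"
        by (intro power_mono norm_triangle_ineq4) auto
      also have "\<dots> \<le> 2 * (norm (g x))\<^sup>2 + 2 * (norm (Q x))\<^sup>2"
        using sum_squares_bound[of "norm (g x)" "norm (Q x)"] by (simp add: power2_sum)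
      finally show ?thesis .
    qed
    then show "AE x in circle_measure. norm ((norm (g x - Q x))\<^sup>2) \<le> norm (2 * (norm (g x))\<^sup>2 + 2 * (norm (Q x))\<^sup>2)"
      by simp
  qed (use g meas in measurable)
  have int_T: "integrable circle_measure (\<lambda>x. (norm (T x))\<^sup>2)"
    by (intro integrable_circle_continuous continuous_intros cont)
  \<comment> \<open>Here \<open>g - P = (g - Q) + T\<close>, and the cross term integrates to 0 by
    \<open>ReT\<close>.\<close>
  have "(LINT x|circle_measure. (norm (g x - P x))\<^sup>2)
      = (LINT x|circle_measure. (norm (g x - Q x))\<^sup>2 + (norm (T x))\<^sup>2 + 2 * Re ((g x - Q x) * cnj (T x)))"
    using norm_add_squared[of "g x - Q x" "T x" for x]
    by (intro Bochner_Integration.integral_cong) (simp_all only: T diff_add_cancel add_diff_eq)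
  also have "\<dots> = (LINT x|circle_measure. (norm (g x - Q x))\<^sup>2) + (LINT x|circle_measure. (norm (T x))\<^sup>2)"
    using int_sq int_T integrable_Re[OF int_rT] ReT
    by (simp del: complex_cnj_mult complex_cnj_diff times_complex.sel minus_complex.sel)
  finally show ?thesis
    unfolding L2_norm_circle_def Q by simp
qed

subsection \<open>The building blocks\<close>

text \<open>The Wallis recursion: \<open>G\<close> vanishes at 0 and 1 because \<open>q\<close> is
  an integer, and its derivative is a combination of two consecutive even powers of the
  cosine.\<close>

lemma integral_cos_power_Suc:
  assumes "q > 0"
  shows "(LINT x|circle_measure. cos (pi * (real q * x)) ^ (2 * Suc d))
    = real (2 * d + 1) / real (2 * d + 2) * (LINT x|circle_measure. cos (pi * (real q * x)) ^ (2 * d))"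
proof -
  define G where "G x = sin (pi * (real q * x)) * cos (pi * (real q * x)) ^ (2 * d + 1)" for x
  define g where "g x = pi * real q * (real (2 * d + 2) * cos (pi * (real q * x)) ^ (2 * Suc d)
    - real (2 * d + 1) * cos (pi * (real q * x)) ^ (2 * d))" for x
  have "(G has_vector_derivative g x) (at x)" for x
  proof -
    define s where "s = sin (pi * (real q * x))"
    define c where "c = cos (pi * (real q * x))"
    have "(G has_real_derivative
        pi * real q * (c * c ^ (2 * d + 1) - real (2 * d + 1) * (s * s) * c ^ (2 * d))) (at x)"
      unfolding G_def s_def c_def
      by (rule derivative_eq_intros refl | simp)+ (simp add: algebra_simps)
    also have "s * s = 1 - c * c"
      using sin_cos_squared_add[of "pi * (real q * x)"] by (simp add: s_def c_def power2_eq_square)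
    also have "pi * real q * (c * c ^ (2 * d + 1) - real (2 * d + 1) * (1 - c * c) * c ^ (2 * d)) = g x"
      by (simp add: g_def flip: c_def) (simp add: algebra_simps)
    finally show ?thesis
      by (simp only: has_real_derivative_iff_has_vector_derivative)
  qed
  then have "(LINT x|circle_measure. g x) = G 1 - G 0"
    by (rule circle_FTC) (auto simp: g_def intro!: continuous_intros)
  also have "\<dots> = 0"
    by (simp add: G_def mult.commute[of pi])
  finally have "(LINT x|circle_measure. g x) = 0" .
  moreover have "(LINT x|circle_measure. g x)
      = pi * real q * (real (2 * d + 2) * (LINT x|circle_measure. cos (pi * (real q * x)) ^ (2 * Suc d))
        - real (2 * d + 1) * (LINT x|circle_measure. cos (pi * (real q * x)) ^ (2 * d)))"
  proof -
    have int: "integrable circle_measure (\<lambda>x. cos (pi * (real q * x)) ^ n)" for n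
      by (intro integrable_circle_continuous continuous_intros)
    show ?thesis
      unfolding g_def
      by (subst integral_mult_right_zero, subst Bochner_Integration.integral_diff)
         (simp_all only: integral_mult_right_zero integrable_mult_right int)
  qed
  ultimately show ?thesis
    using assms by (simp add: divide_simps mult_ac del: power_Suc mult_Suc_right)
qed

text \<open>Each step multiplies the left side by (2d+1)(2d+3)/(2d+2)^2, which is at most 1. This
  gives the decay 1/sqrt(2d+1) without any asymptotics of binomial coefficients.\<close>

lemma integral_cos_power_bound:
  assumes "q > 0"
  shows "(LINT x|circle_measure. cos (pi * (real q * x)) ^ (2 * d))\<^sup>2 * real (2 * d + 1) \<le> 1"
proof (induction d)
  case (Suc d)
  let ?I = "\<lambda>d. LINT x|circle_measure. cos (pi * (real q * x)) ^ (2 * d)"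
  have "(?I (Suc d))\<^sup>2 * real (2 * Suc d + 1)
      = ((?I d)\<^sup>2 * real (2 * d + 1)) * (real (2 * d + 1) * real (2 * d + 3) / (real (2 * d + 2))\<^sup>2)"
    unfolding integral_cos_power_Suc[OF assms] by (simp add: power_divide power2_eq_square field_simps)
  also have "\<dots> \<le> 1 * 1"
    by (intro mult_mono Suc) (auto simp: power2_eq_square divide_simps, simp add: algebra_simps)
  finally show ?case by simp
qed simp

text \<open>A 1-periodic trigonometric polynomial of degree \<open>d\<close> with peaks at the
  integers. For \<open>d = m^2\<close> both its mean and the width of its peak are of order
  1/m.\<close>

definition bump :: "nat \<Rightarrow> real \<Rightarrow> real" where
  "bump d x = (cos (pi * x))\<^sup>2 ^ d"

lemma bump_nonneg [simp]: "0 \<le> bump d x"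
  by (simp add: bump_def)

lemma bump_le_1 [simp]: "bump d x \<le> 1"
  by (simp add: bump_def power_le_one abs_square_le_1)

lemma continuous_on_bump [continuous_intros]:
  fixes f :: "real \<Rightarrow> real"
  shows "continuous_on S f \<Longrightarrow> continuous_on S (\<lambda>x. bump d (f x))"
  unfolding bump_def by (intro continuous_intros)

lemma bump_add_int [simp]: "bump d (x + of_int k) = bump d x"
proof -
  have "(cos (pi * of_int k))\<^sup>2 = 1 - (sin (pi * of_int k))\<^sup>2" by (rule cos_squared_eq)
  also have sin: "sin (pi * of_int k) = 0" by (simp add: mult.commute)
  finally have "(cos (pi * (x + of_int k)))\<^sup>2 = (cos (pi * x))\<^sup>2"
    using sin
    by (simp add: distrib_left cos_add power_mult_distrib)
  then show ?thesis by (simp add: bump_def)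
qed

lemma integral_bump_le:
  assumes "q > 0" "m > 0"
  shows "(LINT x|circle_measure. bump (m\<^sup>2) (real q * x)) \<le> 1 / real m"
proof -
  define I where "I = (LINT x|circle_measure. bump (m\<^sup>2) (real q * x))"
  have "I\<^sup>2 * real (2 * m\<^sup>2 + 1) \<le> 1"
    using integral_cos_power_bound[OF assms(1), of "m\<^sup>2"] by (simp add: I_def bump_def power_mult)
  moreover have "I\<^sup>2 * (real m)\<^sup>2 \<le> I\<^sup>2 * real (2 * m\<^sup>2 + 1)"
    by (intro mult_left_mono) auto
  ultimately have "(I * real m)\<^sup>2 \<le> 1\<^sup>2" by (simp add: power_mult_distrib)
  then have "I * real m \<le> 1" by (rule power2_le_imp_le) simp
  then show ?thesis using assms by (simp add: I_def field_simps)
qed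

text \<open>For the fractional part y of x, pi < 4 gives |sin(pi y)| <= 1/(2m), and Bernoulli's
  inequality bounds (1 - sin^2)^(m^2) from below by 3/4.\<close>

lemma bump_ge_half:
  assumes "m > 0" "frac x \<le> 1 / real (8 * m)"
  shows "1 / 2 \<le> bump (m\<^sup>2) x"
proof -
  define y where "y = frac x"
  have "x = y + of_int \<lfloor>x\<rfloor>" by (simp add: y_def frac_def)
  then have bump: "bump (m\<^sup>2) x = bump (m\<^sup>2) y" by (metis bump_add_int)
  have y: "0 \<le> y" "y \<le> 1 / real (8 * m)" using assms by (auto simp: y_def)
  have "\<bar>sin (pi * y)\<bar> \<le> \<bar>pi * y\<bar>" by (rule abs_sin_x_le_abs_x)
  also have "\<bar>pi * y\<bar> \<le> 4 * (1 / real (8 * m))"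
    using y pi_less_4 by (simp only: abs_mult abs_of_nonneg pi_ge_zero) (intro mult_mono; simp)
  finally have "\<bar>sin (pi * y)\<bar> \<le> 1 / (2 * real m)" by simp
  then have "(sin (pi * y))\<^sup>2 \<le> (1 / (2 * real m))\<^sup>2"
    by (metis abs_ge_zero power2_abs power_mono)
  then have s: "(sin (pi * y))\<^sup>2 \<le> 1 / (4 * (real m)\<^sup>2)"
    by (simp add: power2_eq_square)
  have "1 / 2 \<le> 1 + real (m\<^sup>2) * (- (sin (pi * y))\<^sup>2)"
    using mult_left_mono[OF s, of "real (m\<^sup>2)"] assms by simp
  also have "\<dots> \<le> (1 + - (sin (pi * y))\<^sup>2) ^ (m\<^sup>2)"
    by (intro Bernoulli_inequality) (simp add: abs_square_le_1)
  also have "\<dots> = bump (m\<^sup>2) y"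
    by (simp add: bump_def cos_squared_eq)
  finally show ?thesis by (simp add: bump)
qed

text \<open>A smooth union of the bumps at the first \<open>L\<close> digit positions. Unlike their
  sum it stays in [0,1]; it still dominates each bump, is at most the sum, and remains a
  trigonometric polynomial.\<close>

definition tower :: "nat \<Rightarrow> nat \<Rightarrow> nat \<Rightarrow> real \<Rightarrow> real" where
  "tower d b L x = 1 - (\<Prod>i<L. 1 - bump d (real (b ^ i) * x))"

lemma tower_nonneg [simp]: "0 \<le> tower d b L x"
  by (auto simp: tower_def intro!: prod_le_1)

lemma tower_le_1 [simp]: "tower d b L x \<le> 1"
  by (auto simp: tower_def intro!: prod_nonneg)

lemma continuous_on_tower [continuous_intros]:
  fixes f :: "real \<Rightarrow> real"
  shows "continuous_on S f \<Longrightarrow> continuous_on S (\<lambda>x. tower d b L (f x))"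
  unfolding tower_def by (intro continuous_intros)

lemma tower_periodic: "tower d b L (x + 1) = tower d b L x"
  using bump_add_int[of d _ "int (b ^ i)" for i] by (simp add: tower_def ring_distribs)

lemma bump_le_tower:
  assumes "i < L"
  shows "bump d (real (b ^ i) * x) \<le> tower d b L x"
proof -
  let ?f = "\<lambda>i. 1 - bump d (real (b ^ i) * x)"
  have "(\<Prod>i<L. ?f i) = ?f i * (\<Prod>i\<in>{..<L} - {i}. ?f i)"
    using assms by (intro prod.remove) auto
  also have "\<dots> \<le> ?f i * 1"
    by (intro mult_left_mono prod_le_1) auto
  finally show ?thesis by (simp add: tower_def)
qed

lemma tower_le_sum: "tower d b L x \<le> (\<Sum>i<L. bump d (real (b ^ i) * x))"
  using Weierstrass_prod_ineq[of "{..<L}" "\<lambda>i. bump d (real (b ^ i) * x)"] by (simp add: tower_def)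

text \<open>The factor at position i has degree d b^i; for b >= 2 these degrees sum to at most d
  b^L.\<close>

lemma trig_poly_tower:
  assumes "b \<ge> 2"
  shows "trig_poly (d * b ^ L) (\<lambda>x. of_real (tower d b L x))"
proof -
  have geom: "(\<Sum>i<n. d * b ^ i) \<le> d * b ^ n" for n
  proof (induction n)
    case (Suc n)
    have "(\<Sum>i<Suc n. d * b ^ i) \<le> 2 * (d * b ^ n)" using Suc by simp
    also have "\<dots> \<le> b * (d * b ^ n)" using assms by (intro mult_right_mono) auto
    finally show ?case by (simp add: mult_ac)
  qed simp
  have bump: "trig_poly (b ^ i * d) (\<lambda>x. of_real (bump d (real (b ^ i) * x)))" for i
    using trig_poly_dilate[OF trig_poly_power[OF trig_poly_cos_squared, of d], of "b ^ i"]
    by (simp add: bump_def)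
  have "trig_poly (\<Sum>i<L. b ^ i * d) (\<lambda>x. \<Prod>i<L. of_real (1 - bump d (real (b ^ i) * x)))"
    by (intro trig_poly_prod trig_poly_of_real_one_minus bump)
  then have "trig_poly (d * b ^ L) (\<lambda>x. of_real (\<Prod>i<L. 1 - bump d (real (b ^ i) * x)))"
    using geom[of L] by (auto elim!: trig_poly_mono simp: mult.commute)
  then show ?thesis unfolding tower_def by (rule trig_poly_of_real_one_minus)
qed

lemma integral_tower_le:
  assumes "q > 0" "b > 0" "m > 0"
  shows "(LINT x|circle_measure. tower (m\<^sup>2) b L (real q * x)) \<le> real L / real m"
proof -
  have int: "integrable circle_measure (\<lambda>x. bump (m\<^sup>2) (real (b ^ i * q) * x))" for i
    by (intro integrable_circle_continuous continuous_intros)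
  have "(LINT x|circle_measure. tower (m\<^sup>2) b L (real q * x))
      \<le> (LINT x|circle_measure. (\<Sum>i<L. bump (m\<^sup>2) (real (b ^ i * q) * x)))"
    using tower_le_sum[of "m\<^sup>2" b L "real q * _"]
    by (intro integral_mono integrable_circle_continuous continuous_intros) (simp add: mult.assoc)
  also have "\<dots> = (\<Sum>i<L. (LINT x|circle_measure. bump (m\<^sup>2) (real (b ^ i * q) * x)))"
    using int by (intro Bochner_Integration.integral_sum)
  also have "\<dots> \<le> (\<Sum>i<L. 1 / real m)"
    using assms by (intro sum_mono integral_bump_le) auto
  finally show ?thesis by simp
qed

text \<open>With \<open>m = A * len A\<close> the single bump \<open>bump (m\<^sup>2)\<close> has mean at most \<open>1 / m\<close>, so that \<open>hump A\<close>
  has mean at most \<open>1 / A\<close>, and it is at least \<open>1 / 2\<close> at distance \<open>1 / (8 m)\<close> to the right of the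
  integers, i.e. when the first digit to base \<open>8 m\<close> vanishes.\<close>

definition len :: "nat \<Rightarrow> nat" where "len A = 2 ^ (A + 1)"
definition base :: "nat \<Rightarrow> nat" where "base A = 8 * (A * len A)"
definition hump :: "nat \<Rightarrow> real \<Rightarrow> real" where "hump A = tower ((A * len A)\<^sup>2) (base A) (len A)"
definition deg :: "nat \<Rightarrow> nat" where "deg A = (A * len A)\<^sup>2 * base A ^ len A"

lemma len_pos [simp]: "len A > 0"
  by (simp add: len_def)

lemma base_ge_2: "A > 0 \<Longrightarrow> base A \<ge> 2"
  using mult_pos_pos[of A "len A"] len_pos[of A] by (simp add: base_def del: len_pos)

lemma hump_nonneg [simp]: "0 \<le> hump A x"
  by (simp add: hump_def)

lemma hump_le_1 [simp]: "hump A x \<le> 1"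
  by (simp add: hump_def)

lemma hump_periodic: "hump A (x + 1) = hump A x"
  by (simp add: hump_def tower_periodic)

lemma continuous_on_hump [continuous_intros]:
  fixes f :: "real \<Rightarrow> real"
  shows "continuous_on S f \<Longrightarrow> continuous_on S (\<lambda>x. hump A (f x))"
  unfolding hump_def by (intro continuous_intros)

lemma measurable_hump [measurable]: "hump A \<in> borel_measurable borel"
  using continuous_on_hump[OF continuous_on_id] by (auto intro: borel_measurable_continuous_onI)

lemma trig_poly_hump: "A > 0 \<Longrightarrow> trig_poly (deg A) (\<lambda>x. of_real (hump A x))"
  unfolding hump_def deg_def by (intro trig_poly_tower base_ge_2)

text \<open>There are \<open>len A\<close> positions, each of mean at most
  \<open>1 / (A * len A)\<close>. Uniformity in \<open>q\<close> lets the same bound serve every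
  dilate along the sequence.\<close>

lemma nn_integral_hump:
  assumes "A > 0" "q > 0"
  shows "(\<integral>\<^sup>+x. hump A (real q * x) \<partial>circle_measure) \<le> ennreal (1 / real A)"
proof -
  have "(\<integral>\<^sup>+x. hump A (real q * x) \<partial>circle_measure) = ennreal (LINT x|circle_measure. hump A (real q * x))"
    by (intro nn_integral_eq_integral integrable_circle_continuous continuous_intros) auto
  also have "\<dots> \<le> ennreal (1 / real A)"
    using integral_tower_le[of q "base A" "A * len A" "len A"] assms base_ge_2[of A]
    by (intro ennreal_leI) (simp add: hump_def)
  finally show ?thesis .
qed

lemma hump_ge_half:
  assumes "A > 0" "i < len A" "frac (real (base A ^ i) * x) \<le> 1 / real (base A)"
  shows "1 / 2 \<le> hump A x"
proof -
  have "1 / 2 \<le> bump ((A * len A)\<^sup>2) (real (base A ^ i) * x)"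
    using assms by (intro bump_ge_half) (simp_all add: base_def)
  also have "\<dots> \<le> hump A x"
    unfolding hump_def by (intro bump_le_tower assms)
  finally show ?thesis .
qed

subsection \<open>Independence of digits\<close>

lemma periodic_add_nat:
  assumes "\<And>x::real. x + 1 \<in> S \<longleftrightarrow> x \<in> S"
  shows "x + real n \<in> S \<longleftrightarrow> x \<in> S"
proof (induction n)
  case (Suc n)
  then show ?case using assms[of "x + real n"] by (simp add: add_ac)
qed simp

lemma emeasure_periodic_interval:
  assumes [measurable]: "S \<in> sets borel" and S: "\<And>x::real. x + 1 \<in> S \<longleftrightarrow> x \<in> S" and "k \<le> q"
  shows "emeasure lborel (S \<inter> {real k..<real q}) = of_nat (q - k) * emeasure lborel (S \<inter> {0..<1})"
  using \<open>k \<le> q\<close>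
proof (induction q rule: dec_induct)
  case (step q)
  have "emeasure lborel (S \<inter> {real q..<real q + 1})
      = (\<integral>\<^sup>+x. indicator (S \<inter> {real q..<real q + 1}) x \<partial>lborel)"
    by simp
  also have "\<dots> = (\<integral>\<^sup>+x. indicator (S \<inter> {real q..<real q + 1}) (real q + 1 * x) \<partial>lborel)"
    by (subst nn_integral_real_affine[where c = 1 and t = "real q"]) auto
  also have "\<dots> = (\<integral>\<^sup>+x. indicator (S \<inter> {0..<1}) x \<partial>lborel)"
    using periodic_add_nat[OF S, of _ q]
    by (intro nn_integral_cong) (auto simp: indicator_def add.commute)
  finally have "emeasure lborel (S \<inter> {real q..<real q + 1}) = emeasure lborel (S \<inter> {0..<1})"
    by simp
  moreover have "S \<inter> {real k..<real (Suc q)} = (S \<inter> {real k..<real q}) \<union> (S \<inter> {real q..<real q + 1})"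
    using step by auto
  moreover have "emeasure lborel ((S \<inter> {real k..<real q}) \<union> (S \<inter> {real q..<real q + 1}))
      = emeasure lborel (S \<inter> {real k..<real q}) + emeasure lborel (S \<inter> {real q..<real q + 1})"
    by (intro plus_emeasure[symmetric]) auto
  ultimately show ?case
    using step by (simp add: Suc_diff_le ring_distribs add.commute)
qed simp

text \<open>Substituting y = q x leaves \<open>q - k\<close> full periods of \<open>S\<close>. The
  case k = 0 is invariance under dilation; k = 1 discards the points whose first digit to base
  \<open>q\<close> is zero.\<close>

lemma emeasure_periodic_dilate:
  assumes [measurable]: "S \<in> sets borel" and S: "\<And>x::real. x + 1 \<in> S \<longleftrightarrow> x \<in> S"
    and "k \<le> q" "q > 0"
  shows "emeasure lborel {x \<in> {real k / real q..<1}. real q * x \<in> S}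
    = ennreal (real (q - k) / real q) * emeasure lborel (S \<inter> {0..<1})"
proof -
  let ?T = "{x \<in> {real k / real q..<1}. real q * x \<in> S}"
  have [measurable]: "?T \<in> sets borel" by measurable
  have "of_nat (q - k) * emeasure lborel (S \<inter> {0..<1}) = (\<integral>\<^sup>+x. indicator (S \<inter> {real k..<real q}) x \<partial>lborel)"
    using emeasure_periodic_interval[OF assms(1-3)] by simp
  also have "\<dots> = ennreal (real q) * (\<integral>\<^sup>+x. indicator (S \<inter> {real k..<real q}) (0 + real q * x) \<partial>lborel)"
    using \<open>q > 0\<close> by (subst nn_integral_real_affine[where c = "real q" and t = 0]) auto
  also have "(\<integral>\<^sup>+x. indicator (S \<inter> {real k..<real q}) (0 + real q * x) \<partial>lborel) = (\<integral>\<^sup>+x. indicator ?T x \<partial>lborel)"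
    using \<open>q > 0\<close> by (intro nn_integral_cong) (auto simp: indicator_def field_simps)
  also have "\<dots> = emeasure lborel ?T" by simp
  finally have "ennreal (1 / real q) * (ennreal (real q) * emeasure lborel ?T)
      = ennreal (1 / real q) * (ennreal (real (q - k)) * emeasure lborel (S \<inter> {0..<1}))"
    by (simp add: ennreal_of_nat_eq_real_of_nat)
  then show ?thesis
    using \<open>q > 0\<close> by (simp add: mult.assoc[symmetric] ennreal_mult[symmetric])
qed

text \<open>If \<open>q x\<close> is independent of the event \<open>x \<in> Z\<close>, which has probability \<open>\<rho>\<close>, then
  \<open>regenerative q Z \<rho>\<close> holds. Only the inequality is needed, and it composes.\<close>

definition regenerative :: "nat \<Rightarrow> real set \<Rightarrow> real \<Rightarrow> bool" where
  "regenerative q Z \<rho> \<longleftrightarrow> Z \<in> sets borel \<and> (\<forall>x. x + 1 \<in> Z \<longleftrightarrow> x \<in> Z) \<and>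
    (\<forall>S\<in>sets borel. (\<forall>x. x + 1 \<in> S \<longleftrightarrow> x \<in> S) \<longrightarrow>
      emeasure lborel {x \<in> {0..<1}. x \<in> Z \<and> real q * x \<in> S}
        \<le> ennreal \<rho> * emeasure lborel (S \<inter> {0..<1}))"

lemma regenerative_UNIV: "q > 0 \<Longrightarrow> regenerative q UNIV 1"
  using emeasure_periodic_dilate[of _ 0 q] by (auto simp: regenerative_def)

text \<open>The event says that the first digit to base \<open>b\<close> is nonzero, and
  multiplication by \<open>b\<close> shifts that digit away.\<close>

lemma regenerative_digit:
  assumes "b > 0"
  shows "regenerative b {x. 1 / real b \<le> frac x} (1 - 1 / real b)"
  unfolding regenerative_def
proof (intro conjI ballI impI allI)
  fix S :: "real set" assume "S \<in> sets borel" and "\<forall>x. x + 1 \<in> S \<longleftrightarrow> x \<in> S"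
  moreover have "{x \<in> {0..<1}. x \<in> {x. 1 / real b \<le> frac x} \<and> real b * x \<in> S}
      = {x \<in> {real 1 / real b..<1}. real b * x \<in> S}"
    using assms by (auto simp: frac_eq order.trans[of 0 "1 / real b"])
  ultimately show "emeasure lborel {x \<in> {0..<1}. x \<in> {x. 1 / real b \<le> frac x} \<and> real b * x \<in> S}
      \<le> ennreal (1 - 1 / real b) * emeasure lborel (S \<inter> {0..<1})"
    using emeasure_periodic_dilate[of S 1 b] assms by (simp add: diff_divide_distrib)
next
  have "(\<lambda>x::real. frac x) \<in> borel_measurable borel" unfolding frac_def by measurable
  then show "{x. 1 / real b \<le> frac x} \<in> sets borel" by measurable
qed (simp add: frac_1_eq)

text \<open>The property of \<open>Z\<close> is applied to the test set of those y in
  \<open>Y\<close> with r y in \<open>S\<close>, and then the property of \<open>Y\<close> to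
  \<open>S\<close> itself.\<close>

lemma regenerative_compose:
  assumes "regenerative q Z \<rho>" "regenerative r Y \<sigma>" "0 \<le> \<rho>" "0 \<le> \<sigma>"
  shows "regenerative (q * r) {x \<in> Z. real q * x \<in> Y} (\<rho> * \<sigma>)"
proof -
  have [measurable]: "Z \<in> sets borel" "Y \<in> sets borel"
    and Z: "\<And>x. x + 1 \<in> Z \<longleftrightarrow> x \<in> Z" and Y: "\<And>x. x + 1 \<in> Y \<longleftrightarrow> x \<in> Y"
    using assms by (auto simp: regenerative_def)
  show ?thesis
    unfolding regenerative_def
  proof (intro conjI ballI impI allI)
    fix S :: "real set" assume [measurable]: "S \<in> sets borel" and "\<forall>x. x + 1 \<in> S \<longleftrightarrow> x \<in> S"
    then have S: "x + 1 \<in> S \<longleftrightarrow> x \<in> S" for x by blast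
    let ?S = "{x \<in> Y. real r * x \<in> S}"
    have "x + 1 \<in> ?S \<longleftrightarrow> x \<in> ?S" for x
      using Y periodic_add_nat[OF S, of "real r * x" r] by (simp add: ring_distribs)
    moreover have "?S \<in> sets borel" by measurable
    ultimately have "emeasure lborel {x \<in> {0..<1}. x \<in> Z \<and> real q * x \<in> ?S}
        \<le> ennreal \<rho> * emeasure lborel (?S \<inter> {0..<1})"
      using assms(1) unfolding regenerative_def by blast
    also have "?S \<inter> {0..<1} = {x \<in> {0..<1}. x \<in> Y \<and> real r * x \<in> S}" by auto
    also have "ennreal \<rho> * emeasure lborel \<dots>
        \<le> ennreal \<rho> * (ennreal \<sigma> * emeasure lborel (S \<inter> {0..<1}))"
      using assms(2) S unfolding regenerative_def by (intro mult_left_mono) auto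
    finally show "emeasure lborel {x \<in> {0..<1}. x \<in> {x \<in> Z. real q * x \<in> Y} \<and> real (q * r) * x \<in> S}
        \<le> ennreal (\<rho> * \<sigma>) * emeasure lborel (S \<inter> {0..<1})"
      using assms(3,4) by (simp add: ennreal_mult mult_ac conj_ac)
  next
    fix x
    show "x + 1 \<in> {x \<in> Z. real q * x \<in> Y} \<longleftrightarrow> x \<in> {x \<in> Z. real q * x \<in> Y}"
      using Z periodic_add_nat[OF Y, of "real q * x" q] by (simp add: ring_distribs)
  qed measurable
qed

subsection \<open>The function\<close>

definition scale :: "real \<Rightarrow> real" where "scale A = exp (exp (2 * A * ln A))"

text \<open>The factor \<open>t + 1\<close> is the amplitude of stage \<open>t\<close>; the power of
  2 is the price of replacing a sum over stages by its largest term.\<close>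

definition weight :: "nat \<Rightarrow> real" where "weight t = 2 ^ (t + 1) * real (t + 1)"

lemma weight_ge_1: "1 \<le> weight t"
proof -
  have "1 * 1 \<le> weight t" unfolding weight_def by (intro mult_mono one_le_power) auto
  then show ?thesis by simp
qed

lemma weight_nonneg [simp]: "0 \<le> weight t"
  using weight_ge_1[of t] by simp

lemma scale_mono:
  assumes "1 \<le> A" "A \<le> B"
  shows "scale A \<le> scale B"
  using assms unfolding scale_def by (auto intro!: mult_mono)

lemma scale_ge:
  assumes "1 \<le> A"
  shows "A \<le> scale A"
proof -
  have "ln A \<le> 2 * A * ln A"
    using assms mult_right_mono[of 1 "2 * A" "ln A"] by simp
  then have "exp (ln A) \<le> exp (2 * A * ln A)" by simp
  also have "\<dots> \<le> scale A"
    unfolding scale_def using exp_ge_add_one_self[of "exp (2 * A * ln A)"] by linarith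
  finally show ?thesis using assms by simp
qed

text \<open>The logarithm of the degree is of order A^2 2^A, whereas that of \<open>scale A\<close>
  is A^(2A).\<close>

lemma eventually_deg_le_scale: "\<forall>\<^sub>F A in sequentially. real (deg A) \<le> scale (real A)"
proof -
  have "\<forall>\<^sub>F x in at_top. 2 * (ln x + (x + 1) * ln (2::real)) + 2 powr (x + 1) * (ln 8 + (ln x + (x + 1) * ln 2))
      \<le> exp (2 * x * ln x)"
    by real_asymp
  then have "\<forall>\<^sub>F A in sequentially. 2 * (ln (real A) + (real A + 1) * ln 2)
      + 2 powr (real A + 1) * (ln 8 + (ln (real A) + (real A + 1) * ln 2)) \<le> exp (2 * real A * ln (real A))"
    by (rule eventually_compose_filterlim[OF _ filterlim_real_sequentially])
  then show ?thesis
    using eventually_gt_at_top[of 0]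
  proof eventually_elim
    case (elim A)
    define m where "m = real A * 2 ^ (A + 1)"
    have m: "m > 0" using elim by (simp add: m_def)
    have ln_m: "ln m = ln (real A) + (real A + 1) * ln 2"
      using elim by (simp add: m_def ln_mult ln_realpow algebra_simps)
    have len: "real (len A) = 2 powr (real A + 1)"
      by (simp add: len_def powr_add powr_realpow)
    have "real (deg A) = m\<^sup>2 * (8 * m) ^ len A"
      by (simp add: deg_def base_def m_def len_def)
    then have "ln (real (deg A)) = 2 * ln m + real (len A) * (ln 8 + ln m)"
      using m by (simp add: ln_mult ln_realpow distrib_left)
    also have "\<dots> \<le> exp (2 * real A * ln (real A))"
      using elim by (simp only: ln_m len)
    finally have "exp (ln (real (deg A))) \<le> scale (real A)" by (simp add: scale_def)
    moreover have "real (deg A) > 0" using m by (simp add: \<open>real (deg A) = _\<close>)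
    ultimately show ?case by simp
  qed
qed

text \<open>Each requirement holds for all large \<open>A\<close>, so the parameters can be chosen
  one after the other. The bound by \<open>\<omega>\<close> will control the L^2 tails; the last
  one, whose exponent grows with \<open>t\<close>, will control all moments at once.\<close>

lemma admissible_scales:
  assumes "admissible N\<^sub>0 \<omega>"
  obtains A :: "nat \<Rightarrow> nat" where "strict_mono A" "\<And>t. 0 < A t" "\<And>t. real (deg (A t)) \<le> scale (real (A t))"
    "\<And>t. N\<^sub>0 \<le> scale (real (A t))"
    "\<And>t. (weight t)\<^sup>2 * 2 ^ Suc t / real (A t) \<le> (\<omega> (scale (real (A t))))\<^sup>2"
    "\<And>t. weight t ^ t * 2 ^ t \<le> real (A t)"
proof -
  define P where "P t A \<longleftrightarrow> 0 < A \<and> real (deg A) \<le> scale (real A) \<and> N\<^sub>0 \<le> scale (real A) \<and>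
    (weight t)\<^sup>2 * 2 ^ Suc t / real A \<le> (\<omega> (scale (real A)))\<^sup>2 \<and> weight t ^ t * 2 ^ t \<le> real A" for t A :: nat
  have "\<forall>\<^sub>F A in sequentially. P t A" for t
  proof -
    have "filterlim (\<lambda>A. A powr (1/2) * \<omega> (scale A)) at_top at_top"
      using assms by (simp add: admissible_def scale_def)
    then have "\<forall>\<^sub>F A in at_top. sqrt ((weight t)\<^sup>2 * 2 ^ Suc t) \<le> A powr (1/2) * \<omega> (scale A)"
      by (simp add: filterlim_at_top)
    then have 1: "\<forall>\<^sub>F A in sequentially. sqrt ((weight t)\<^sup>2 * 2 ^ Suc t) \<le> real A powr (1/2) * \<omega> (scale (real A))"
      by (rule eventually_compose_filterlim[OF _ filterlim_real_sequentially])
    have "filterlim scale at_top at_top" unfolding scale_def by real_asymp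
    then have "\<forall>\<^sub>F A in at_top. N\<^sub>0 \<le> scale A" by (simp add: filterlim_at_top)
    then have 2: "\<forall>\<^sub>F A in sequentially. N\<^sub>0 \<le> scale (real A)"
      by (rule eventually_compose_filterlim[OF _ filterlim_real_sequentially])
    have 3: "\<forall>\<^sub>F A in sequentially. weight t ^ t * 2 ^ t \<le> real A"
      using filterlim_real_sequentially by (simp add: filterlim_at_top)
    show ?thesis
      using 1 2 3 eventually_deg_le_scale eventually_gt_at_top[of 0]
    proof eventually_elim
      case (elim A)
      have "(weight t)\<^sup>2 * 2 ^ Suc t = (sqrt ((weight t)\<^sup>2 * 2 ^ Suc t))\<^sup>2"
        by (rule real_sqrt_pow2[symmetric]) simp
      also have "\<dots> \<le> (real A powr (1/2) * \<omega> (scale (real A)))\<^sup>2"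
        using elim(1) by (intro power_mono) auto
      also have "\<dots> = real A * (\<omega> (scale (real A)))\<^sup>2"
        by (simp add: powr_half_sqrt power_mult_distrib)
      finally show ?case using elim by (simp add: P_def field_simps)
    qed
  qed
  then have ex: "\<exists>A. P t A \<and> B < A" for t B
    using eventually_happens[OF eventually_conj[OF _ eventually_gt_at_top[of B]], of "P t"] by auto
  obtain A where "\<forall>t. P t (A t) \<and> A t < A (Suc t)"
    using dependent_nat_choice[of P "\<lambda>_ x y. x < y"] ex by metis
  then show ?thesis
    using that[of A] by (simp add: P_def strict_mono_Suc_iff)
qed

text \<open>The weights \<open>2\<^bsup>t+1\<^esup>\<close> replace a sum by the largest of its terms, up to a constant.\<close>

lemma suminf_power_le:
  fixes u :: "nat \<Rightarrow> real"
  assumes u: "\<And>t. 0 \<le> u t" and "p > 0"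
  shows "(\<Sum>t. ennreal (u t)) ^ p \<le> (\<Sum>t. ennreal ((2 ^ Suc t * u t) ^ p))"
proof (cases "(\<Sum>t. ennreal ((2 ^ Suc t * u t) ^ p))")
  case (real s)
  \<comment> \<open>With \<open>r\<close> the p-th root of the right side, every \<open>u t\<close>
    is at most r / 2^(t+1), and these bounds sum to \<open>r\<close>.\<close>
  define r where "r = root p s"
  have r: "0 \<le> r" "r ^ p = s"
    using real \<open>p > 0\<close> by (auto simp: r_def)
  have "u t \<le> r * (1 / 2) ^ Suc t" for t
  proof -
    have "ennreal ((2 ^ Suc t * u t) ^ p) \<le> (\<Sum>t. ennreal ((2 ^ Suc t * u t) ^ p))"
      using sum_le_suminf[of "\<lambda>t. ennreal ((2 ^ Suc t * u t) ^ p)" "{t}"] by simp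
    then have "(2 ^ Suc t * u t) ^ p \<le> r ^ p"
      using real r by simp
    then have "2 ^ Suc t * u t \<le> r"
      using r \<open>p > 0\<close> power_mono_iff[of "2 ^ Suc t * u t" r p] u by simp
    then show ?thesis by (simp add: field_simps)
  qed
  then have "(\<Sum>t. ennreal (u t)) \<le> (\<Sum>t. ennreal (r * (1 / 2) ^ Suc t))"
    by (intro suminf_le ennreal_leI) auto
  also have "\<dots> = ennreal (r * 1)"
    using r by (intro suminf_ennreal_eq sums_mult power_half_series) auto
  finally have "(\<Sum>t. ennreal (u t)) ^ p \<le> ennreal r ^ p"
    by (intro power_mono) auto
  then show ?thesis using real r by (simp add: ennreal_power)
qed simp

section \<open>The series over the stages: moments, integrability and L^2 decay\<close>

locale scales =
  fixes A :: "nat \<Rightarrow> nat"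
  assumes strict_mono_A: "strict_mono A"
    and A_pos [simp]: "0 < A t"
    and A_ge: "weight t ^ t * 2 ^ t \<le> real (A t)"
begin

definition tail :: "nat \<Rightarrow> real \<Rightarrow> ennreal" where
  "tail s x = (\<Sum>t. ennreal (real (t + s + 1) * hump (A (t + s)) x))"

text \<open>Summing in \<open>ennreal\<close> avoids convergence questions; where the series
  diverges, \<open>F\<close> takes the default value 0, so pointwise lower bounds for
  \<open>F\<close> require \<open>tail 0 x < top\<close>.\<close>

definition F :: "real \<Rightarrow> real" where "F x = enn2real (tail 0 x)"

definition mean :: real where "mean = (LINT x|circle_measure. F x)"

lemma measurable_tail [measurable]: "tail s \<in> borel_measurable borel"
  unfolding tail_def by measurable

lemma measurable_F [measurable]: "F \<in> borel_measurable borel"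
  unfolding F_def by measurable

lemma F_nonneg [simp]: "0 \<le> F x"
  by (simp add: F_def)

lemma F_periodic: "F (x + 1) = F x"
  by (simp add: F_def tail_def hump_periodic)

text \<open>Since a hump lies in [0,1], its p-th power is at most itself, so all moments are
  governed by the mean 1/A.\<close>

lemma nn_integral_tail_power:
  assumes "q > 0" "p > 0"
  shows "(\<integral>\<^sup>+x. tail s (real q * x) ^ p \<partial>circle_measure)
    \<le> (\<Sum>t. ennreal (weight (t + s) ^ p / real (A (t + s))))"
proof -
  have "(\<integral>\<^sup>+x. tail s (real q * x) ^ p \<partial>circle_measure)
      \<le> (\<integral>\<^sup>+x. (\<Sum>t. ennreal (weight (t + s) ^ p) * ennreal (hump (A (t + s)) (real q * x))) \<partial>circle_measure)"
  proof (intro nn_integral_mono)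
    fix x
    let ?u = "\<lambda>t. real (t + s + 1) * hump (A (t + s)) (real q * x)"
    have "tail s (real q * x) ^ p \<le> (\<Sum>t. ennreal ((2 ^ Suc t * ?u t) ^ p))"
      unfolding tail_def using \<open>p > 0\<close> by (intro suminf_power_le) auto
    also have "\<dots> \<le> (\<Sum>t. ennreal (weight (t + s) ^ p * hump (A (t + s)) (real q * x)))"
    proof (intro suminf_le summableI ennreal_leI)
      fix t
      let ?h = "hump (A (t + s)) (real q * x)"
      have "(2 ^ Suc t * ?u t) ^ p = (2 ^ Suc t * real (t + s + 1)) ^ p * ?h ^ p"
        by (simp add: power_mult_distrib mult_ac)
      also have "\<dots> \<le> weight (t + s) ^ p * ?h"
      proof (intro mult_mono power_mono)
        show "2 ^ Suc t * real (t + s + 1) \<le> weight (t + s)"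
          unfolding weight_def by (intro mult_mono power_increasing) auto
        show "?h ^ p \<le> ?h"
          using power_decreasing[of 1 p ?h] \<open>p > 0\<close> by simp
      qed (use weight_ge_1[of "t + s"] in auto)
      finally show "(2 ^ Suc t * ?u t) ^ p \<le> weight (t + s) ^ p * ?h" .
    qed
    finally show "tail s (real q * x) ^ p
        \<le> (\<Sum>t. ennreal (weight (t + s) ^ p) * ennreal (hump (A (t + s)) (real q * x)))"
      by (simp add: ennreal_mult' ennreal_mult'')
  qed
  also have "\<dots> = (\<Sum>t. (\<integral>\<^sup>+x. ennreal (weight (t + s) ^ p) * ennreal (hump (A (t + s)) (real q * x)) \<partial>circle_measure))"
    by (intro nn_integral_suminf borel_measurable_circle) measurable
  also have "\<dots> = (\<Sum>t. ennreal (weight (t + s) ^ p) * (\<integral>\<^sup>+x. ennreal (hump (A (t + s)) (real q * x)) \<partial>circle_measure))"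
    by (subst nn_integral_cmult) (auto intro!: borel_measurable_circle)
  also have "\<dots> \<le> (\<Sum>t. ennreal (weight (t + s) ^ p) * ennreal (1 / real (A (t + s))))"
    using \<open>q > 0\<close> by (intro suminf_le summableI mult_left_mono nn_integral_hump) auto
  also have "\<dots> = (\<Sum>t. ennreal (weight (t + s) ^ p / real (A (t + s))))"
    by (subst ennreal_mult[symmetric]) auto
  finally show ?thesis .
qed

lemma nn_integral_tail_power_finite:
  assumes "q > 0" "p > 0"
  shows "(\<integral>\<^sup>+x. tail 0 (real q * x) ^ p \<partial>circle_measure) < top"
proof -
  have "summable (\<lambda>t. weight t ^ p / real (A t))"
  proof (rule summable_comparison_test')
    show "summable (\<lambda>t. (1 / 2 :: real) ^ t)" by (simp add: summable_geometric)
    \<comment> \<open>From \<open>t = p\<close> on, the exponent \<open>t\<close> in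
      \<open>A_ge\<close> dominates the fixed \<open>p\<close>, leaving a geometric series.\<close>
    fix t assume "p \<le> t"
    have "weight t ^ p * 2 ^ t \<le> weight t ^ t * 2 ^ t"
      using weight_ge_1[of t] \<open>p \<le> t\<close> by (intro mult_right_mono power_increasing) auto
    also note A_ge[of t]
    finally have "weight t ^ p / real (A t) \<le> 1 / 2 ^ t"
      using A_pos[of t] by (simp add: field_simps)
    then show "norm (weight t ^ p / real (A t)) \<le> (1 / 2) ^ t"
      using weight_ge_1[of t] by (simp add: power_one_over)
  qed
  then have "(\<Sum>t. ennreal (weight t ^ p / real (A t))) \<noteq> top"
    by (intro ennreal_suminf_neq_top) auto
  then have "(\<Sum>t. ennreal (weight t ^ p / real (A t))) < top"
    by (rule less_top[THEN iffD1])
  with nn_integral_tail_power[OF assms, of 0] show ?thesis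
    unfolding add_0_right by (rule le_less_trans)
qed

text \<open>One null set for all integer dilations at once, hence for all points at which
  \<open>F\<close> is evaluated in the averages.\<close>

lemma AE_tail_finite: "AE x in circle_measure. \<forall>q>0. tail 0 (real q * x) < top"
proof -
  have "AE x in circle_measure. tail 0 (real q * x) < top" if "q > 0" for q
  proof -
    have "AE x in circle_measure. tail 0 (real q * x) ^ 1 \<noteq> \<infinity>"
      using nn_integral_tail_power_finite[OF that, of 1]
      by (intro nn_integral_PInf_AE borel_measurable_circle) auto
    then show ?thesis
      by (rule AE_mp) (auto intro!: AE_I2 simp: top.not_eq_extremum[symmetric] infinity_ennreal_def)
  qed
  then show ?thesis by (simp add: AE_all_countable)
qed

lemma hump_le_F:
  assumes "tail 0 x < top"
  shows "real (t + 1) * hump (A t) x \<le> F x"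
proof -
  have "ennreal (real (t + 1) * hump (A t) x) \<le> tail 0 x"
    using sum_le_suminf[OF summableI, of "{t}" "\<lambda>t. ennreal (real (t + 0 + 1) * hump (A (t + 0)) x)"]
    unfolding tail_def by (simp only: finite.intros sum.insert sum.empty empty_iff not_False_eq_True
        add_0_right zero_le simp_thms)
  also have "\<dots> = ennreal (F x)" using assms by (simp add: F_def)
  finally show ?thesis by simp
qed

lemma F_eq_tail:
  assumes "tail 0 x < top"
  shows "ennreal (F x - (\<Sum>t<s. real (t + 1) * hump (A t) x)) = tail s x"
    and "(\<Sum>t<s. real (t + 1) * hump (A t) x) \<le> F x"
proof -
  let ?S = "\<Sum>t<s. real (t + 1) * hump (A t) x"
  have "tail 0 x = tail s x + (\<Sum>t<s. ennreal (real (t + 1) * hump (A t) x))"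
    unfolding tail_def
    using suminf_offset[OF summableI, of "\<lambda>t. ennreal (real (t + 1) * hump (A t) x)" s]
    by (simp only: add_0_right)
  then have eq: "ennreal (F x) = tail s x + ennreal ?S"
    using assms by (simp add: F_def sum_ennreal)
  then have "ennreal ?S \<le> ennreal (F x)" by simp
  then show le: "?S \<le> F x" by simp
  have "ennreal (F x - ?S) + ennreal ?S = tail s x + ennreal ?S"
    using le eq by (simp add: sum_nonneg flip: ennreal_plus)
  then show "ennreal (F x - ?S) = tail s x"
    by simp
qed

lemma integrable_F_power:
  assumes "p > 0"
  shows "integrable circle_measure (\<lambda>x. F x ^ p)"
proof (rule integrableI_nonneg)
  have "(\<integral>\<^sup>+x. ennreal (F x ^ p) \<partial>circle_measure) \<le> (\<integral>\<^sup>+x. tail 0 (real 1 * x) ^ p \<partial>circle_measure)"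
    by (intro nn_integral_mono) (auto simp: F_def ennreal_enn2real_if power_mono simp flip: ennreal_power)
  also have "\<dots> < top" using assms by (intro nn_integral_tail_power_finite) auto
  finally show "(\<integral>\<^sup>+x. ennreal (F x ^ p) \<partial>circle_measure) < \<infinity>" by simp
qed (auto intro!: borel_measurable_circle)

lemma mean_nonneg: "0 \<le> mean"
  unfolding mean_def by (intro Bochner_Integration.integral_nonneg) auto

lemma integral_F_minus_mean: "(LINT x|circle_measure. F x - mean) = 0"
  using integrable_F_power[of 1] finite_measure_circle
  by (simp add: finite_measure.integrable_const mean_def)

text \<open>Integer moments suffice: a^p <= 1 + a^k for a >= 0 and k the ceiling of p.\<close>

lemma F_minus_mean_Lp:
  assumes "1 \<le> p"
  shows "(\<lambda>x. F x - mean) \<in> Lp_circle p"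
proof -
  define k where "k = nat \<lceil>p\<rceil>"
  have k: "k > 0" "p \<le> real k" using assms by (simp_all add: k_def)
  interpret finite_measure circle_measure by (rule finite_measure_circle)
  have "integrable circle_measure (\<lambda>x. norm (F x - mean) powr p)"
  proof (rule Bochner_Integration.integrable_bound)
    show "integrable circle_measure (\<lambda>x. 1 + 2 ^ k * (F x ^ k + mean ^ k))"
      using integrable_F_power[OF k(1)] by simp
    have "norm (F x - mean) powr p \<le> 1 + 2 ^ k * (F x ^ k + mean ^ k)" for x
    proof -
      let ?a = "norm (F x - mean)"
      have "?a powr p \<le> 1 + ?a ^ k"
      proof (cases "?a \<le> 1")
        case True
        then have "?a powr p \<le> 1" using assms by (intro powr_le1) auto
        then show ?thesis by (simp add: add_increasing2)
      next
        case False
        then have "?a powr p \<le> ?a powr real k" using k by (intro powr_mono) auto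
        then show ?thesis using False by (simp add: powr_realpow)
      qed
      also have "?a \<le> 2 * max (F x) mean"
        using mean_nonneg F_nonneg[of x] unfolding real_norm_def by linarith
      then have "?a ^ k \<le> (2 * max (F x) mean) ^ k"
        by (intro power_mono) auto
      also have "\<dots> \<le> 2 ^ k * (F x ^ k + mean ^ k)"
        using mean_nonneg by (auto simp: power_mult_distrib max_def)
      finally show ?thesis by simp
    qed
    then show "AE x in circle_measure. norm (norm (F x - mean) powr p) \<le> norm (1 + 2 ^ k * (F x ^ k + mean ^ k))"
      using mean_nonneg by simp
  qed (intro borel_measurable_circle, measurable)
  then show ?thesis
    by (auto simp: Lp_circle_def F_periodic intro!: borel_measurable_circle)
qed

text \<open>The comparison polynomial consists of the first \<open>s\<close> stages minus the mean.
  What remains is \<open>tail s\<close> almost everywhere, and its second moment is bounded by the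
  case p = 2.\<close>

lemma L2_decay:
  assumes deg: "\<And>t. t < s \<Longrightarrow> deg (A t) \<le> N"
    and tail: "(\<Sum>t. ennreal (weight (t + s) ^ 2 / real (A (t + s)))) \<le> ennreal (e\<^sup>2)" and "0 \<le> e"
  shows "L2_norm_circle (\<lambda>x. complex_of_real (F x - mean)
    - fourier_partial_sum N (\<lambda>y. complex_of_real (F y - mean)) x) \<le> e"
proof -
  let ?g = "\<lambda>x. complex_of_real (F x - mean)"
  define P where "P x = (\<Sum>t<s. real (t + 1) * hump (A t) x) - mean" for x
  have P: "trig_poly N (\<lambda>x. complex_of_real (P x))"
    unfolding P_def of_real_diff of_real_sum of_real_mult
    using deg by (intro trig_poly_diff trig_poly_const trig_poly_sum trig_poly_scale)
      (auto intro!: trig_poly_mono[OF trig_poly_hump])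
  have meas: "?g \<in> borel_measurable circle_measure"
    by (intro borel_measurable_circle) measurable
  have sq: "integrable circle_measure (\<lambda>x. (norm (?g x))\<^sup>2)"
    using F_minus_mean_Lp[of 2] by (simp add: Lp_circle_def del: of_real_diff)
  have "L2_norm_circle (\<lambda>x. ?g x - fourier_partial_sum N ?g x)
      \<le> sqrt (LINT x|circle_measure. (norm (?g x - of_real (P x)))\<^sup>2)"
    by (rule fourier_partial_sum_best_approximation[OF meas sq P])
  also have "\<dots> \<le> e"
  proof (rule real_le_lsqrt)
    have [measurable]: "P \<in> borel_measurable borel" unfolding P_def by measurable
    have "(\<integral>\<^sup>+x. ennreal ((norm (?g x - of_real (P x)))\<^sup>2) \<partial>circle_measure)
        = (\<integral>\<^sup>+x. tail s (real 1 * x) ^ 2 \<partial>circle_measure)"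
    proof (rule nn_integral_cong_AE, use AE_tail_finite in eventually_elim)
      case (elim x)
      then have fin: "tail 0 x < top" by (metis mult_1 of_nat_1 zero_less_one)
      have "norm (?g x - of_real (P x)) = norm (F x - mean - P x)"
        by (metis norm_of_real of_real_diff real_norm_def)
      also have "\<dots> = F x - (\<Sum>t<s. real (t + 1) * hump (A t) x)"
        using F_eq_tail(2)[OF fin, of s] by (simp add: P_def)
      finally show ?case
        using F_eq_tail[OF fin, of s] by (simp add: ennreal_power[symmetric])
    qed
    also have "\<dots> \<le> (\<Sum>t. ennreal (weight (t + s) ^ 2 / real (A (t + s))))"
      by (intro nn_integral_tail_power) auto
    also note tail
    finally show "(LINT x|circle_measure. (norm (?g x - of_real (P x)))\<^sup>2) \<le> e\<^sup>2"
      by (intro integral_real_bounded) auto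
  qed (use \<open>0 \<le> e\<close> in auto)
  finally show ?thesis .
qed

end

section \<open>Probability that a range of digits avoids zero\<close>

lemma emeasure_regenerative_le:
  assumes "regenerative q Z \<rho>"
  shows "emeasure lborel {x \<in> {0..<1}. x \<in> Z} \<le> ennreal \<rho>"
  using assms[unfolded regenerative_def, THEN conjunct2, THEN conjunct2, THEN bspec[of _ _ UNIV]]
  by simp

text \<open>Digits are appended one at a time. Positions below \<open>m\<close> are unconstrained
  and contribute the factor 1, in accordance with the truncated difference
  \<open>n - m\<close>.\<close>

lemma regenerative_block:
  assumes "b > 0"
  shows "regenerative (b ^ n) {x. \<forall>i<n. m \<le> i \<longrightarrow> 1 / real b \<le> frac (real (b ^ i) * x)}
    ((1 - 1 / real b) ^ (n - m))"
proof (induction n)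
  case 0
  then show ?case using regenerative_UNIV[of 1] by simp
next
  case (Suc n)
  show ?case
  proof (cases "m \<le> n")
    case True
    have "regenerative (b ^ n * b)
      {x \<in> {x. \<forall>i<n. m \<le> i \<longrightarrow> 1 / real b \<le> frac (real (b ^ i) * x)}.
        real (b ^ n) * x \<in> {x. 1 / real b \<le> frac x}}
      ((1 - 1 / real b) ^ (n - m) * (1 - 1 / real b))"
      using assms by (intro regenerative_compose Suc regenerative_digit) auto
    also have "b ^ n * b = b ^ Suc n" by simp
    also have "(1 - 1 / real b) ^ (n - m) * (1 - 1 / real b) = (1 - 1 / real b) ^ (Suc n - m)"
      using True by (simp add: Suc_diff_le)
    also have "{x \<in> {x. \<forall>i<n. m \<le> i \<longrightarrow> 1 / real b \<le> frac (real (b ^ i) * x)}.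
        real (b ^ n) * x \<in> {x. 1 / real b \<le> frac x}}
      = {x. \<forall>i<Suc n. m \<le> i \<longrightarrow> 1 / real b \<le> frac (real (b ^ i) * x)}"
      using True by (auto simp del: of_nat_power simp: less_Suc_eq)
    finally show ?thesis .
  next
    case False
    have "regenerative (b ^ n * b)
      {x \<in> {x. \<forall>i<n. m \<le> i \<longrightarrow> 1 / real b \<le> frac (real (b ^ i) * x)}. real (b ^ n) * x \<in> UNIV}
      ((1 - 1 / real b) ^ (n - m) * 1)"
      using assms by (intro regenerative_compose Suc regenerative_UNIV) auto
    also have "b ^ n * b = b ^ Suc n" by simp
    also have "(1 - 1 / real b) ^ (n - m) * 1 = (1 - 1 / real b) ^ (Suc n - m)"
      using False by simp
    also have "{x \<in> {x. \<forall>i<n. m \<le> i \<longrightarrow> 1 / real b \<le> frac (real (b ^ i) * x)}. real (b ^ n) * x \<in> UNIV}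
      = {x. \<forall>i<Suc n. m \<le> i \<longrightarrow> 1 / real b \<le> frac (real (b ^ i) * x)}"
      using False by (auto simp del: of_nat_power simp: less_Suc_eq)
    finally show ?thesis .
  qed
qed

subsection \<open>The lacunary sequence\<close>

context scales
begin

text \<open>For t > 0, stage \<open>t\<close> serves exactly the blocks k with A(t-1) <= k <
  A(t).\<close>

definition stage :: "nat \<Rightarrow> nat" where "stage k = (LEAST t. k < A t)"

lemma less_A_stage: "k < A (stage k)"
  unfolding stage_def
proof (rule LeastI)
  show "k < A (Suc k)"
    using strict_mono_imp_increasing[OF strict_mono_A, of "Suc k"] by simp
qed

lemma stage_le: "k < A t \<Longrightarrow> stage k \<le> t"
  unfolding stage_def by (rule Least_le)

lemma stage_gt: "A t \<le> k \<Longrightarrow> t < stage k"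
  using less_A_stage[of k] strict_mono_less[OF strict_mono_A, of t "stage k"] by simp

abbreviation (input) B :: "nat \<Rightarrow> nat" where "B k \<equiv> base (A (stage k))"
abbreviation (input) L :: "nat \<Rightarrow> nat" where "L k \<equiv> len (A (stage k))"

text \<open>From k < A(stage k) the exponent in \<open>len\<close> is at least k + 2. Thus the first
  2^k positions, lost to the shifts within block \<open>k\<close>, are at most a quarter of
  all.\<close>

lemma L_ge: "4 * 2 ^ k \<le> L k"
proof -
  have "(2::nat) ^ (k + 2) \<le> L k"
    unfolding len_def using less_A_stage[of k] by (intro power_increasing) auto
  then show ?thesis by simp
qed

lemma B_ge_2: "2 \<le> B k"
  by (simp add: base_ge_2)

text \<open>The factor B^L skips all digits read by a block, so that different blocks read disjoint
  digits.\<close>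

definition block_start :: "nat \<Rightarrow> nat" where "block_start k = (\<Prod>i<k. B i ^ L i)"

lemma block_start_pos [simp]: "0 < block_start k"
  unfolding block_start_def by (intro prod_pos zero_less_power) (simp add: base_def)

text \<open>The \<open>k\<close>-th block consists of the indices \<open>2\<^bsup>k\<^esup> \<le> j < 2\<^bsup>k+1\<^esup>\<close>, so it outweighs all previous ones.\<close>

definition freq :: "nat \<Rightarrow> nat" where
  "freq j = block_start (floor_log j) * B (floor_log j) ^ (j - 2 ^ floor_log j)"

lemma freq_block: "i < 2 ^ k \<Longrightarrow> freq (2 ^ k + i) = block_start k * B k ^ i"
  using floor_log_eqI[of "2 ^ k + i" k] by (simp add: freq_def)

lemma freq_pos [simp]: "0 < freq j"
  unfolding freq_def using B_ge_2[of "floor_log j"] by simp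

lemma nat_block:
  assumes "j \<ge> (1::nat)"
  obtains k i where "j = 2 ^ k + i" "i < 2 ^ k"
  using that[of "floor_log j" "j - 2 ^ floor_log j"] floor_log_exp2_le[of j] floor_log_exp2_gt[of j] assms
  by simp

text \<open>Inside a block the ratio is \<open>B k\<close>. At its end the exponent jumps from 2^k -
  1 to \<open>L k\<close>, which is larger.\<close>

lemma freq_Suc_ge:
  assumes "j \<ge> 1"
  shows "2 * freq j \<le> freq (Suc j)"
proof -
  obtain k i where j: "j = 2 ^ k + i" "i < 2 ^ k" using nat_block[OF assms] .
  show ?thesis
  proof (cases "Suc i < 2 ^ k")
    case True
    then have "freq (Suc j) = B k * freq j"
      using j freq_block[of "Suc i" k] freq_block[of i k] by simp
    then show ?thesis using B_ge_2[of k] by simp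
  next
    case False
    then have "Suc j = 2 ^ Suc k + 0" using j by simp
    then have "freq (Suc j) = block_start (Suc k)"
      using freq_block[of 0 "Suc k"] by simp
    also have "\<dots> = block_start k * B k ^ L k" by (simp add: block_start_def)
    also have "\<dots> \<ge> block_start k * B k ^ Suc i"
      using False j L_ge[of k] B_ge_2[of k] by (intro mult_left_mono power_increasing) auto
    also have "block_start k * B k ^ Suc i = B k * freq j"
      using j freq_block[of i k] by simp
    finally show ?thesis
      by (rule order.trans[OF mult_right_mono[OF B_ge_2[of k] zero_le]])
  qed
qed

text \<open>A zero digit at a position \<open>i \<ge> 2\<^bsup>k\<^esup>\<close> makes the hump large at all points \<open>B\<^bsup>l\<^esup> x\<close>
  with \<open>l < 2\<^bsup>k\<^esup>\<close>, since it is then the digit number \<open>i - l\<close> of these points.\<close>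

definition failure :: "nat \<Rightarrow> real set" where
  "failure k = {x. \<forall>i<L k. 2 ^ k \<le> i \<longrightarrow> 1 / real (B k) \<le> frac (real (B k ^ i) * x)}"

text \<open>Failure has probability (1 - 1/B)^(L - 2^k) <= exp(-(L - 2^k)/B). At least L/2 positions
  remain and B = 8 A L, whence the 16.\<close>

definition fail_bound :: "nat \<Rightarrow> real" where "fail_bound k = exp (- 1 / (16 * real (A (stage k))))"

lemma regenerative_failure: "regenerative (B k ^ L k) (failure k) (fail_bound k)"
proof -
  have "(1 - 1 / real (B k)) ^ (L k - 2 ^ k) \<le> exp (- 1 / real (B k)) ^ (L k - 2 ^ k)"
    using B_ge_2[of k] exp_ge_add_one_self[of "- 1 / real (B k)"] by (intro power_mono) auto
  also have "\<dots> = exp (- (real (L k - 2 ^ k) / real (B k)))"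
    by (simp flip: exp_of_nat_mult)
  also have "\<dots> \<le> fail_bound k"
  proof -
    have "real (L k) \<le> 2 * real (L k - 2 ^ k)"
      using L_ge[of k] by linarith
    then have "real (L k) * (16 * real (A (stage k))) \<le> (2 * real (L k - 2 ^ k)) * (16 * real (A (stage k)))"
      by (intro mult_right_mono) auto
    then have "1 / (16 * real (A (stage k))) \<le> real (L k - 2 ^ k) / real (B k)"
      using A_pos[of "stage k"] by (simp add: base_def field_simps)
    then show ?thesis by (simp add: fail_bound_def)
  qed
  finally have le: "(1 - 1 / real (B k)) ^ (L k - 2 ^ k) \<le> fail_bound k" .
  have "regenerative (B k ^ L k) (failure k) ((1 - 1 / real (B k)) ^ (L k - 2 ^ k))"
    unfolding failure_def using B_ge_2[of k] by (intro regenerative_block) simp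
  then show ?thesis
    \<comment> \<open>The definition asks for an upper bound, so the factor may be enlarged.\<close>
    using le unfolding regenerative_def by (meson ennreal_leI mult_right_mono order_trans zero_le)
qed

lemma regenerative_failures:
  "regenerative (block_start n) {x. \<forall>k<n. T \<le> k \<longrightarrow> real (block_start k) * x \<in> failure k}
    (\<Prod>k<n. if T \<le> k then fail_bound k else 1)"
proof (induction n)
  case 0
  then show ?case using regenerative_UNIV[of 1] by (simp add: block_start_def)
next
  case (Suc n)
  define Y where "Y = (if T \<le> n then failure n else UNIV)"
  have "regenerative (B n ^ L n) Y (if T \<le> n then fail_bound n else 1)"
    using regenerative_failure[of n] regenerative_UNIV[of "B n ^ L n"] B_ge_2[of n] by (simp add: Y_def)
  then have "regenerative (block_start n * B n ^ L n)
      {x \<in> {x. \<forall>k<n. T \<le> k \<longrightarrow> real (block_start k) * x \<in> failure k}. real (block_start n) * x \<in> Y}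
      ((\<Prod>k<n. if T \<le> k then fail_bound k else 1) * (if T \<le> n then fail_bound n else 1))"
    by (intro regenerative_compose Suc) (auto intro!: prod_nonneg simp: fail_bound_def)
  moreover have "{x \<in> {x. \<forall>k<n. T \<le> k \<longrightarrow> real (block_start k) * x \<in> failure k}. real (block_start n) * x \<in> Y}
      = {x. \<forall>k<Suc n. T \<le> k \<longrightarrow> real (block_start k) * x \<in> failure k}"
    by (auto simp: Y_def less_Suc_eq)
  ultimately show ?case by (simp add: block_start_def)
qed

text \<open>If A(t) >= 2m, at least A(t)/2 blocks lie in [m, A(t)), each with factor at most
  exp(-1/(16 A(t))). Together they gain exp(-1/32), and this can be repeated beyond any
  point.\<close>

lemma prod_fail_bound_small: "\<exists>n. (\<Prod>k<n. if T \<le> k then fail_bound k else 1) \<le> exp (- real r / 32)"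
proof (induction r)
  case 0
  then show ?case by (intro exI[of _ 0]) simp
next
  case (Suc r)
  let ?f = "\<lambda>k. if T \<le> k then fail_bound k else 1"
  obtain n where n: "(\<Prod>k<n. ?f k) \<le> exp (- real r / 32)" using Suc by blast
  define m where "m = max n T"
  \<comment> \<open>A strictly increasing sequence of naturals satisfies A(t) >= t, so this choice
    gives A(t) >= 2m.\<close>
  define t where "t = 2 * m"
  have t: "2 * m \<le> A t" "m \<le> A t"
    using strict_mono_imp_increasing[OF strict_mono_A, of t] by (auto simp: t_def)
  have f1: "0 \<le> ?f k" "?f k \<le> 1" for k by (auto simp: fail_bound_def)
  have "(\<Prod>k\<in>{m..<A t}. ?f k) \<le> (\<Prod>k\<in>{m..<A t}. exp (- 1 / (16 * real (A t))))"
  proof (intro prod_mono conjI f1)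
    fix k assume k: "k \<in> {m..<A t}"
    then have "A (stage k) \<le> A t"
      using stage_le[of k t] strict_mono_A by (simp add: strict_mono_less_eq)
    then have "1 / (16 * real (A t)) \<le> 1 / (16 * real (A (stage k)))"
      by (intro divide_left_mono) auto
    then show "?f k \<le> exp (- 1 / (16 * real (A t)))"
      using k by (simp add: fail_bound_def m_def)
  qed
  also have "\<dots> = exp (- (real (A t - m) / (16 * real (A t))))"
    by (simp flip: exp_of_nat_mult)
  also have "\<dots> \<le> exp (- 1 / 32)"
  proof -
    have "1 / 32 \<le> real (A t - m) / (16 * real (A t))"
      using t A_pos[of t] by (simp add: field_simps of_nat_diff)
    then show ?thesis by simp
  qed
  finally have 1: "(\<Prod>k\<in>{m..<A t}. ?f k) \<le> exp (- 1 / 32)" .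
  have "(\<Prod>k<A t. ?f k) = (\<Prod>k<n. ?f k) * (\<Prod>k\<in>{n..<m}. ?f k) * (\<Prod>k\<in>{m..<A t}. ?f k)"
    using t by (simp only: lessThan_atLeast0 prod.atLeastLessThan_concat m_def max.cobounded1 zero_le)
  also have "\<dots> \<le> exp (- real r / 32) * 1 * exp (- 1 / 32)"
    using f1 by (intro mult_mono n 1 prod_le_1 mult_nonneg_nonneg prod_nonneg) auto
  also have "\<dots> = exp (- real (Suc r) / 32)"
    by (simp add: field_simps flip: exp_add)
  finally show ?case by blast
qed

text \<open>This plays the part of the second Borel-Cantelli lemma: the set where all blocks from
  \<open>T\<close> on fail has measure at most exp(-r/32) for every \<open>r\<close>.\<close>

lemma AE_infinitely_many_successes:
  "AE x in circle_measure. \<forall>T. \<exists>k\<ge>T. real (block_start k) * x \<notin> failure k"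
proof -
  have "AE x in circle_measure. \<exists>k\<ge>T. real (block_start k) * x \<notin> failure k" for T
  proof -
    have [measurable]: "failure k \<in> sets borel" for k
      using regenerative_failure[of k] by (simp add: regenerative_def)
    let ?Z = "{x \<in> {0..<1}. \<forall>k. T \<le> k \<longrightarrow> real (block_start k) * x \<in> failure k}"
    have bound: "emeasure lborel ?Z \<le> ennreal (exp (- real r / 32))" for r
    proof -
      obtain n where n: "(\<Prod>k<n. if T \<le> k then fail_bound k else 1) \<le> exp (- real r / 32)"
        using prod_fail_bound_small by blast
      define Y where "Y = {x. \<forall>k<n. T \<le> k \<longrightarrow> real (block_start k) * x \<in> failure k}"
      have reg: "regenerative (block_start n) Y (\<Prod>k<n. if T \<le> k then fail_bound k else 1)"
        unfolding Y_def by (rule regenerative_failures)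
      have "emeasure lborel ?Z \<le> emeasure lborel {x \<in> {0..<1}. x \<in> Y}"
      proof (rule emeasure_mono)
        show "?Z \<subseteq> {x \<in> {0..<1}. x \<in> Y}" unfolding Y_def by blast
        have [measurable]: "Y \<in> sets borel" using reg unfolding regenerative_def by blast
        show "{x \<in> {0..<1}. x \<in> Y} \<in> sets lborel" by measurable
      qed
      also have "\<dots> \<le> ennreal (\<Prod>k<n. if T \<le> k then fail_bound k else 1)"
        using reg by (rule emeasure_regenerative_le)
      also have "\<dots> \<le> ennreal (exp (- real r / 32))"
        using n by (simp add: ennreal_leI)
      finally show ?thesis .
    qed
    have "(\<lambda>r. exp (- real r / 32)) \<longlonglongrightarrow> 0" by real_asymp
    then have "(\<lambda>r. ennreal (exp (- real r / 32))) \<longlonglongrightarrow> ennreal 0"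
      by (rule tendsto_ennrealI)
    then have "emeasure lborel ?Z \<le> ennreal 0"
      by (rule LIMSEQ_le_const) (use bound in blast)
    moreover have "?Z \<in> sets lborel" by measurable
    ultimately have "?Z \<in> null_sets lborel" by (simp add: null_sets_def)
    then show ?thesis
      unfolding AE_circle_iff by (rule AE_I') blast
  qed
  then show ?thesis by (simp add: AE_all_countable)
qed

lemma F_ge_on_block:
  assumes fin: "\<forall>q>0. tail 0 (real q * x) < top"
    and success: "real (block_start k) * x \<notin> failure k"
    and j: "j \<in> {2 ^ k..<2 ^ Suc k}"
  shows "real (stage k + 1) / 2 \<le> F (real (freq j) * x)"
proof -
  obtain i where i: "i < L k" "2 ^ k \<le> i" "frac (real (B k ^ i) * (real (block_start k) * x)) < 1 / real (B k)"
    using success by (auto simp: failure_def not_le)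
  define l where "l = j - 2 ^ k"
  have l: "l < 2 ^ k" "j = 2 ^ k + l" using j by (auto simp: l_def)
  \<comment> \<open>Since l < 2^k <= i, the difference \<open>i - l\<close> is not truncated, and
    the zero digit sits at that position of the dilated point.\<close>
  have "real (B k ^ (i - l)) * (real (freq j) * x) = real (B k ^ (i - l) * B k ^ l) * (real (block_start k) * x)"
    using l by (simp add: freq_block)
  also have "B k ^ (i - l) * B k ^ l = B k ^ i"
    using i l by (simp flip: power_add)
  finally have "frac (real (B k ^ (i - l)) * (real (freq j) * x)) \<le> 1 / real (B k)"
    using i(3) by (simp only: less_imp_le)
  then have "1 / 2 \<le> hump (A (stage k)) (real (freq j) * x)"
    using i by (intro hump_ge_half[of _ "i - l"]) auto
  then have "real (stage k + 1) * (1 / 2) \<le> real (stage k + 1) * hump (A (stage k)) (real (freq j) * x)"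
    by (intro mult_left_mono) auto
  also have "\<dots> \<le> F (real (freq j) * x)"
    using fin by (intro hump_le_F) auto
  finally show ?thesis by simp
qed

text \<open>\<open>N\<close> is the last index of block \<open>k\<close>. The block holds more than
  half of the terms, each at least M/2 with M = stage k + 1, and the earlier terms are nonnegative
  before centering.\<close>

lemma average_ge:
  assumes fin: "\<forall>q>0. tail 0 (real q * x) < top"
    and success: "real (block_start k) * x \<notin> failure k"
    and N: "N = 2 ^ Suc k - 1"
  shows "real (stage k + 1) / 4 - mean \<le> 1 / real N * (\<Sum>j=1..N. F (real (freq j) * x) - mean)"
proof -
  let ?M = "real (stage k + 1)"
  have "1 \<le> (2::nat) ^ k" by simp
  then have "0 < N" "N \<le> 2 * 2 ^ k" unfolding N power_Suc by linarith+
  then have N': "0 < N" "real N \<le> 2 * 2 ^ k"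
    using of_nat_mono[of N "2 * 2 ^ k", where ?'a = real] by simp_all
  have "2 ^ k * (?M / 2) = (\<Sum>j\<in>{(2::nat) ^ k..<2 ^ Suc k}. ?M / 2)"
    by simp
  also have "\<dots> \<le> (\<Sum>j\<in>{2 ^ k..<2 ^ Suc k}. F (real (freq j) * x))"
    by (intro sum_mono F_ge_on_block[OF fin success])
  also have "\<dots> \<le> (\<Sum>j=1..N. F (real (freq j) * x))"
    by (intro sum_mono2) (auto simp: N intro: order.trans[of _ "2 ^ k"])
  finally have S: "2 ^ k * (?M / 2) \<le> (\<Sum>j=1..N. F (real (freq j) * x))" .
  have "real N * (?M / 4) \<le> 2 * 2 ^ k * (?M / 4)"
    using N' by (intro mult_right_mono) auto
  also have "2 * 2 ^ k * (?M / 4) = 2 ^ k * (?M / 2)" by simp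
  also note S
  finally have "real N * (?M / 4) \<le> (\<Sum>j=1..N. F (real (freq j) * x))" .
  then show ?thesis
    using N' by (simp add: sum_subtractf field_simps)
qed

lemma AE_limsup_averages:
  "AE x in circle_measure.
    limsup (\<lambda>N. ereal (1 / real N * (\<Sum>j=1..N. F (real (freq j) * x) - mean))) = \<infinity>"
  using AE_tail_finite AE_infinitely_many_successes
proof eventually_elim
  case (elim x)
  let ?a = "\<lambda>N. 1 / real N * (\<Sum>j=1..N. F (real (freq j) * x) - mean)"
  show ?case
  proof (rule ccontr)
    assume "limsup (\<lambda>N. ereal (?a N)) \<noteq> \<infinity>"
    then obtain r :: nat where "limsup (\<lambda>N. ereal (?a N)) < ereal (real r)"
      using less_PInf_Ex_of_nat by auto
    then have "\<forall>\<^sub>F N in sequentially. ereal (?a N) < ereal (real r)"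
      by (rule Limsup_lessD)
    then obtain N\<^sub>1 where N\<^sub>1: "\<And>N. N \<ge> N\<^sub>1 \<Longrightarrow> ?a N < real r"
      by (auto simp: eventually_sequentially)
    obtain t :: nat where t: "4 * (real r + mean) \<le> real t"
      using real_arch_simple by blast
    \<comment> \<open>k >= A(t) forces the stage beyond \<open>t\<close>, while k >=
      \<open>N\<^sub>1\<close> puts the end of the block in the range of the assumed upper
      bound.\<close>
    obtain k where k: "k \<ge> max N\<^sub>1 (A t)" "real (block_start k) * x \<notin> failure k"
      using elim(2) by blast
    have "k < 2 ^ k" by (rule less_exp)
    then have "N\<^sub>1 \<le> 2 ^ Suc k - 1" using k by (simp only: power_Suc max.bounded_iff) linarith
    then have "real (stage k + 1) / 4 - mean < real r"
      using average_ge[OF elim(1) k(2) refl] N\<^sub>1 by (meson le_less_trans)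
    then have "real (stage k + 1) < 4 * (real r + mean)"
      by (simp add: field_simps)
    also note t
    finally have "stage k + 1 < t" by (simp only: of_nat_less_iff)
    moreover have "t < stage k" using k by (intro stage_gt) simp
    ultimately show False by simp
  qed
qed

end

section \<open>Combining decay, lacunarity and divergence\<close>

theorem corollary1p3:
  fixes N\<^sub>0 :: real and \<omega> :: "real \<Rightarrow> real"
  assumes "admissible N\<^sub>0 \<omega>"
  shows "\<exists>(f :: real \<Rightarrow> real) (n :: nat \<Rightarrow> nat).
    f \<in> (\<Inter>p\<in>{1..}. Lp_circle p) \<and>
    (LINT x|circle_measure. f x) = 0 \<and>
    (\<forall>j\<ge>1. 0 < n j) \<and>
    strict_mono_on {1..} n \<and>
    (\<forall>j\<ge>1. real (n (j + 1)) / real (n j) \<ge> 2) \<and>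
    (\<exists>C>0. \<forall>\<^sub>F N in sequentially.
       L2_norm_circle
         (\<lambda>x. complex_of_real (f x) - fourier_partial_sum N (\<lambda>y. complex_of_real (f y)) x)
         \<le> C * \<omega> (real N)) \<and>
    (AE x in circle_measure.
       limsup (\<lambda>N. ereal (1 / real N * (\<Sum>j=1..N. f (real (n j) * x)))) = \<infinity>)"
proof -
  obtain A where A: "strict_mono A" "\<And>t. 0 < A t" "\<And>t. real (deg (A t)) \<le> scale (real (A t))"
    "\<And>t. N\<^sub>0 \<le> scale (real (A t))"
    "\<And>t. (weight t)\<^sup>2 * 2 ^ Suc t / real (A t) \<le> (\<omega> (scale (real (A t))))\<^sup>2"
    "\<And>t. weight t ^ t * 2 ^ t \<le> real (A t)"
    using admissible_scales[OF assms] by metis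
  interpret scales A by standard (fact A)+
  have \<omega>: "\<And>x. N\<^sub>0 \<le> x \<Longrightarrow> 0 < \<omega> x" "\<And>x y. N\<^sub>0 \<le> x \<Longrightarrow> x \<le> y \<Longrightarrow> \<omega> y \<le> \<omega> x"
    using assms by (auto simp: admissible_def monotone_on_def)
  let ?f = "\<lambda>x. F x - mean"
  have decay: "L2_norm_circle (\<lambda>x. complex_of_real (?f x) - fourier_partial_sum N (\<lambda>y. complex_of_real (?f y)) x)
      \<le> 1 * \<omega> (real N)" if N: "N\<^sub>0 \<le> real N" for N
  proof -
    \<comment> \<open>\<open>s\<close> is the first stage whose scale exceeds \<open>N\<close>: all
      earlier stages have degree at most \<open>N\<close>, and all later scales, lying beyond
      \<open>N\<close>, have \<open>\<omega>\<close> at most its value at \<open>N\<close>.\<close>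
    define s where "s = (LEAST s. real N < scale (real (A s)))"
    have "real N < real (A (Suc N))"
      using strict_mono_imp_increasing[OF A(1), of "Suc N"] by simp
    also have "real (A (Suc N)) \<le> scale (real (A (Suc N)))"
      by (intro scale_ge) (simp add: Suc_le_eq)
    finally have s: "real N < scale (real (A s))"
      unfolding s_def by (rule LeastI)
    have deg: "deg (A t) \<le> N" if "t < s" for t
      using not_less_Least[OF that[unfolded s_def]] A(3)[of t] by linarith
    \<comment> \<open>The factor 2^(t+s+1) built into the choice of scales makes the tail geometric
      with total at most the square of \<open>\<omega>\<close> at \<open>N\<close>, which is why the
      constant 1 suffices.\<close>
    have "weight (t + s) ^ 2 / real (A (t + s)) \<le> (\<omega> (real N))\<^sup>2 * (1 / 2) ^ Suc t" for t
    proof -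
      have "scale (real (A s)) \<le> scale (real (A (t + s)))"
        using A(1) by (intro scale_mono) (simp_all add: strict_mono_less_eq Suc_le_eq)
      then have "\<omega> (scale (real (A (t + s)))) \<le> \<omega> (real N)"
        using N s by (intro \<omega>(2)) auto
      then have "(\<omega> (scale (real (A (t + s)))))\<^sup>2 \<le> (\<omega> (real N))\<^sup>2"
        using \<omega>(1)[OF A(4)[of "t + s"]] by (intro power_mono) auto
      with A(5)[of "t + s"] have "(weight (t + s))\<^sup>2 / real (A (t + s)) * 2 ^ Suc (t + s) \<le> (\<omega> (real N))\<^sup>2"
        by simp
      moreover have "(weight (t + s))\<^sup>2 / real (A (t + s)) * 2 ^ Suc t
          \<le> (weight (t + s))\<^sup>2 / real (A (t + s)) * 2 ^ Suc (t + s)"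
        by (intro mult_left_mono power_increasing) auto
      ultimately have "(weight (t + s))\<^sup>2 / real (A (t + s)) * 2 ^ Suc t \<le> (\<omega> (real N))\<^sup>2"
        by linarith
      then show ?thesis
        by (simp add: power_one_over pos_le_divide_eq)
    qed
    then have "(\<Sum>t. ennreal (weight (t + s) ^ 2 / real (A (t + s)))) \<le> (\<Sum>t. ennreal ((\<omega> (real N))\<^sup>2 * (1 / 2) ^ Suc t))"
      by (intro suminf_le ennreal_leI) auto
    also have "\<dots> = ennreal ((\<omega> (real N))\<^sup>2 * 1)"
      by (intro suminf_ennreal_eq sums_mult power_half_series) auto
    finally have "(\<Sum>t. ennreal (weight (t + s) ^ 2 / real (A (t + s)))) \<le> ennreal ((\<omega> (real N))\<^sup>2)"
      unfolding mult_1_right .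
    then show ?thesis
      unfolding mult_1 using \<omega>(1)[OF N] by (intro L2_decay[OF deg]) auto
  qed
  have "\<forall>\<^sub>F N in sequentially. N\<^sub>0 \<le> real N"
    using filterlim_real_sequentially by (simp add: filterlim_at_top)
  then have "\<forall>\<^sub>F N in sequentially.
      L2_norm_circle (\<lambda>x. complex_of_real (?f x) - fourier_partial_sum N (\<lambda>y. complex_of_real (?f y)) x)
        \<le> 1 * \<omega> (real N)"
    by (rule eventually_mono) (rule decay)
  then have L2: "\<exists>C>0. \<forall>\<^sub>F N in sequentially.
      L2_norm_circle (\<lambda>x. complex_of_real (?f x) - fourier_partial_sum N (\<lambda>y. complex_of_real (?f y)) x)
        \<le> C * \<omega> (real N)"
    using zero_less_one by blast
  have mono: "strict_mono_on {1..} freq"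
  proof (rule strict_mono_onI)
    fix i j :: nat assume "i \<in> {1..}" "i < j"
    have freq_less: "freq k < freq (Suc k)" if "k \<ge> 1" for k
      using freq_Suc_ge[OF that] freq_pos[of k] by linarith
    from \<open>i < j\<close> have "Suc i \<le> j" by simp
    then show "freq i < freq j"
    proof (induction j rule: dec_induct)
      case base
      then show ?case using \<open>i \<in> {1..}\<close> by (intro freq_less) simp
    next
      case (step j)
      then show ?case using freq_less[of j] by simp
    qed
  qed
  have ratio: "real (freq (j + 1)) / real (freq j) \<ge> 2" if "j \<ge> 1" for j
  proof -
    have "real (2 * freq j) \<le> real (freq (Suc j))"
      using freq_Suc_ge[OF that] by (rule of_nat_mono)
    then show ?thesis using freq_pos[of j] by (simp add: pos_le_divide_eq)
  qed
  show ?thesis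
  proof (intro exI[of _ ?f] exI[of _ freq] conjI)
    show "?f \<in> (\<Inter>p\<in>{1..}. Lp_circle p)" using F_minus_mean_Lp by simp
    show "strict_mono_on {1..} freq" by (fact mono)
    show "\<forall>j\<ge>1. real (freq (j + 1)) / real (freq j) \<ge> 2" using ratio by blast
  qed (fact integral_F_minus_mean L2 AE_limsup_averages | simp)+
qed

end
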